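(* Let $\mathfrak{g}$ be an affine Kac-Moody algebra over $\mathbb{C}$. Then $\mathcal{H}(\mathfrak{g})=\varnothing$, i.e. there is no $\mathfrak{g}$-module whose restriction to $U(\mathfrak{h})$ is free of rank $1$, where $\mathfrak{h}$ is the standard Cartan subalgebra of $\mathfrak{g}$.
   Context: A generalized Cartan matrix is an integer matrix $A=(a_{ij})_{1\le i,j\le l}$ with $a_{ii}=2$, $a_{ij}\le 0$ for $i\ne j$, and $a_{ij}=0\Leftrightarrow a_{ji}=0$; all such matrices are assumed indecomposable (there is no partition of $\{1,\dots,l\}$ into two nonempty parts $I_1,I_2$ with $a_{ij}=0$ for all $i\in I_1,j\in I_2$). The Kac-Moody algebra $\mathfrak{g}=\mathfrak{g}(A)$ over $\mathbb{C}$: take a vector space $\mathfrak{h}$ (the Cartan subalgebra) of dimension $2l-\mathrm{rank}\,A$ with linearly independent simple roots $\alpha_1,\dots,\alpha_l\in\mathfrak{h}^*$ and linearly independent simple coroots $\alpha_1^\vee,\dots,\alpha_l^\vee\in\mathfrak{h}$ such that $\alpha_j(\alpha_i^\vee)=a_{ij}$; let $\tilde{\mathfrak{g}}(A)$ be the Lie algebra generated by $\mathfrak{h}$ and $e_i,f_i$ ($1\le i\le l$) with relations $[\mathfrak{h},\mathfrak{h}]=0$, $[h,e_i]=\alpha_i(h)e_i$, $[h,f_i]=-\alpha_i(h)f_i$ ($h\in\mathfrak{h}$), $[e_i,f_j]=\delta_{ij}\alpha_i^\vee$; then $\mathfrak{g}(A)$ is the quotient of $\tilde{\mathfrak{g}}(A)$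 by its unique maximal ideal intersecting $\mathfrak{h}$ trivially. $\mathfrak{g}(A)$ is called affine if $A$ is of affine type in the usual sense (indecomposable, and $Au=0$ for some vector $u$ with all entries positive); in Kac's classification these are the types $A_1^{(1)}$, $A_l^{(1)}(l\ge2)$, $B_l^{(1)}(l\ge3)$, $C_l^{(1)}(l\ge2)$, $D_l^{(1)}(l\ge4)$, $E_l^{(1)}(l=6,7,8)$, $F_4^{(1)}$, $G_2^{(1)}$, $A_2^{(2)}$, $A_{2l}^{(2)}(l\ge2)$, $A_{2l-1}^{(2)}(l\ge3)$, $D_{l+1}^{(2)}(l\ge2)$, $E_6^{(2)}$, $D_4^{(3)}$. $\mathcal{H}(\mathfrak{g})$ denotes the full subcategory of $\mathfrak{g}$-modules $M$ whose restriction to $U(\mathfrak{h})$ is free of rank $1$ (i.e. $\mathrm{Res}^{\mathfrak{g}}_{\mathfrak{h}}M\cong U(\mathfrak{h})$ with $U(\mathfrak h)$ acting by multiplication). *)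

theory Defs
  imports "HOL-Analysis.Analysis"
begin

section \<open>Generalized Cartan matrices and realizations\<close>

definition generalized_cartan_matrix :: "int^'i^'i \<Rightarrow> bool" where
  "generalized_cartan_matrix A \<longleftrightarrow>
     (\<forall>i. A $ i $ i = 2) \<and>
     (\<forall>i j. i \<noteq> j \<longrightarrow> A $ i $ j \<le> 0) \<and>
     (\<forall>i j. A $ i $ j = 0 \<longleftrightarrow> A $ j $ i = 0)"

definition indecomposable_matrix :: "int^'i^'i \<Rightarrow> bool" where
  "indecomposable_matrix A \<longleftrightarrow>
     \<not> (\<exists>I J. I \<noteq> {} \<and> J \<noteq> {} \<and> I \<inter> J = {} \<and> I \<union> J = UNIV \<and>
             (\<forall>i\<in>I. \<forall>j\<in>J. A $ i $ j = 0))"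

definition affine_cartan_matrix :: "int^'i^'i \<Rightarrow> bool" where
  "affine_cartan_matrix A \<longleftrightarrow>
     generalized_cartan_matrix A \<and> indecomposable_matrix A \<and>
     (\<exists>u :: real^'i. (\<forall>i. u $ i > 0) \<and> map_matrix real_of_int A *v u = 0)"

text \<open>
  The Cartan subalgebra is a whole type \<open>'h\<close> with scalar multiplication \<open>sh\<close>;
  \<open>\<alpha> i\<close> are the simple roots and \<open>\<alpha>v i\<close> the simple coroots.
\<close>

definition realization ::
  "int^'i^'i \<Rightarrow> (complex \<Rightarrow> 'h \<Rightarrow> 'h) \<Rightarrow> ('i \<Rightarrow> 'h \<Rightarrow> complex) \<Rightarrow> ('i \<Rightarrow> 'h::ab_group_add) \<Rightarrow> bool" where
  "realization A sh \<alpha> \<alpha>v \<longleftrightarrow>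
     (\<exists>B. finite_dimensional_vector_space sh B \<and>
          card B = 2 * CARD('i) - rank (map_matrix complex_of_int A)) \<and>
     (\<forall>i. Vector_Spaces.linear sh (*) (\<alpha> i)) \<and>
     (\<forall>c. (\<forall>h. (\<Sum>i\<in>UNIV. c i * \<alpha> i h) = 0) \<longrightarrow> (\<forall>i. c i = 0)) \<and>
     (\<forall>c. (\<Sum>i\<in>UNIV. sh (c i) (\<alpha>v i)) = 0 \<longrightarrow> (\<forall>i. c i = 0)) \<and>
     (\<forall>i j. \<alpha> j (\<alpha>v i) = complex_of_int (A $ i $ j))"


section \<open>Complex algebras by generators and relations\<close>

text \<open>
  Neither associativity nor antisymmetry of the product is built in: the record carries
  Lie algebras (\<open>alg_mult\<close> is then the bracket) as well as associative algebras.
\<close>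

record 'a complex_algebra =
  alg_carrier :: "'a set"
  alg_zero :: 'a
  alg_add :: "'a \<Rightarrow> 'a \<Rightarrow> 'a"
  alg_smult :: "complex \<Rightarrow> 'a \<Rightarrow> 'a"
  alg_mult :: "'a \<Rightarrow> 'a \<Rightarrow> 'a"

definition quotient_algebra :: "'a complex_algebra \<Rightarrow> ('a \<times> 'a) set \<Rightarrow> 'a set complex_algebra" where
  "quotient_algebra L R =
     \<lparr> alg_carrier = alg_carrier L // R,
       alg_zero = R `` {alg_zero L},
       alg_add = (\<lambda>S T. \<Union>x\<in>S. \<Union>y\<in>T. R `` {alg_add L x y}),
       alg_smult = (\<lambda>c S. \<Union>x\<in>S. R `` {alg_smult L c x}),
       alg_mult = (\<lambda>S T. \<Union>x\<in>S. \<Union>y\<in>T. R `` {alg_mult L x y}) \<rparr>"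

datatype 'x alg_term =
    Gen 'x
  | Zero
  | Add "'x alg_term" "'x alg_term"
  | Smult complex "'x alg_term"
  | Mult "'x alg_term" "'x alg_term"

definition term_algebra :: "'x alg_term complex_algebra" where
  "term_algebra =
     \<lparr> alg_carrier = UNIV, alg_zero = Zero, alg_add = Add, alg_smult = Smult, alg_mult = Mult \<rparr>"

text \<open>
  The least congruence containing \<open>rel\<close> for which the quotient of the term algebra is a
  complex vector space with bilinear product.
\<close>

inductive presented_eq :: "('x alg_term \<Rightarrow> 'x alg_term \<Rightarrow> bool) \<Rightarrow> 'x alg_term \<Rightarrow> 'x alg_term \<Rightarrow> bool"
  for rel where
  relation: "rel x y \<Longrightarrow> presented_eq rel x y"
| refl: "presented_eq rel x x"
| sym: "presented_eq rel x y \<Longrightarrow> presented_eq rel y x"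
| trans: "presented_eq rel x y \<Longrightarrow> presented_eq rel y z \<Longrightarrow> presented_eq rel x z"
| cong_add: "presented_eq rel x x' \<Longrightarrow> presented_eq rel y y' \<Longrightarrow>
    presented_eq rel (Add x y) (Add x' y')"
| cong_smult: "presented_eq rel x x' \<Longrightarrow> presented_eq rel (Smult c x) (Smult c x')"
| cong_mult: "presented_eq rel x x' \<Longrightarrow> presented_eq rel y y' \<Longrightarrow>
    presented_eq rel (Mult x y) (Mult x' y')"
| add_assoc: "presented_eq rel (Add (Add x y) z) (Add x (Add y z))"
| add_comm: "presented_eq rel (Add x y) (Add y x)"
| add_zero: "presented_eq rel (Add Zero x) x"
| add_neg: "presented_eq rel (Add (Smult (-1) x) x) Zero"
| smult_add: "presented_eq rel (Smult c (Add x y)) (Add (Smult c x) (Smult c y))"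
| add_smult: "presented_eq rel (Smult (c + d) x) (Add (Smult c x) (Smult d x))"
| smult_smult: "presented_eq rel (Smult c (Smult d x)) (Smult (c * d) x)"
| smult_one: "presented_eq rel (Smult 1 x) x"
| mult_add_left: "presented_eq rel (Mult (Add x y) z) (Add (Mult x z) (Mult y z))"
| mult_add_right: "presented_eq rel (Mult x (Add y z)) (Add (Mult x y) (Mult x z))"
| mult_smult_left: "presented_eq rel (Mult (Smult c x) y) (Smult c (Mult x y))"
| mult_smult_right: "presented_eq rel (Mult x (Smult c y)) (Smult c (Mult x y))"

definition presented_rel :: "('x alg_term \<Rightarrow> 'x alg_term \<Rightarrow> bool) \<Rightarrow> ('x alg_term \<times> 'x alg_term) set" where
  "presented_rel rel = {(x, y). presented_eq rel x y}"

definition presented_algebra ::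
  "('x alg_term \<Rightarrow> 'x alg_term \<Rightarrow> bool) \<Rightarrow> 'x alg_term set complex_algebra" where
  "presented_algebra rel = quotient_algebra term_algebra (presented_rel rel)"


section \<open>The Kac--Moody algebra of a realization\<close>

datatype ('i, 'h) km_gen = E 'i | F 'i | H 'h

inductive km_relation ::
  "(complex \<Rightarrow> 'h \<Rightarrow> 'h) \<Rightarrow> ('i \<Rightarrow> 'h \<Rightarrow> complex) \<Rightarrow> ('i \<Rightarrow> 'h::ab_group_add) \<Rightarrow>
   ('i, 'h) km_gen alg_term \<Rightarrow> ('i, 'h) km_gen alg_term \<Rightarrow> bool"
  for sh \<alpha> \<alpha>v where
  alternating: "km_relation sh \<alpha> \<alpha>v (Mult x x) Zero"
| jacobi: "km_relation sh \<alpha> \<alpha>v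
    (Add (Mult x (Mult y z)) (Add (Mult y (Mult z x)) (Mult z (Mult x y)))) Zero"
| cartan_add: "km_relation sh \<alpha> \<alpha>v (Gen (H (h + h'))) (Add (Gen (H h)) (Gen (H h')))"
| cartan_smult: "km_relation sh \<alpha> \<alpha>v (Gen (H (sh c h))) (Smult c (Gen (H h)))"
| cartan_commute: "km_relation sh \<alpha> \<alpha>v (Mult (Gen (H h)) (Gen (H h'))) Zero"
| cartan_e: "km_relation sh \<alpha> \<alpha>v (Mult (Gen (H h)) (Gen (E i))) (Smult (\<alpha> i h) (Gen (E i)))"
| cartan_f: "km_relation sh \<alpha> \<alpha>v (Mult (Gen (H h)) (Gen (F i))) (Smult (- \<alpha> i h) (Gen (F i)))"
| e_f: "km_relation sh \<alpha> \<alpha>v (Mult (Gen (E i)) (Gen (F j)))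
    (if i = j then Gen (H (\<alpha>v i)) else Zero)"

text \<open>
  The matrix \<open>A\<close> does not occur explicitly: it is recorded in \<open>\<alpha>\<close> and \<open>\<alpha>v\<close> through
  \<open>\<alpha> j (\<alpha>v i) = A $ i $ j\<close>. \<open>tilde_algebra\<close> is the algebra on which only the defining
  relations are imposed; the Kac--Moody algebra is its quotient by \<open>km_radical\<close>.
\<close>

definition tilde_algebra ::
  "(complex \<Rightarrow> 'h \<Rightarrow> 'h) \<Rightarrow> ('i \<Rightarrow> 'h \<Rightarrow> complex) \<Rightarrow> ('i \<Rightarrow> 'h::ab_group_add) \<Rightarrow>
   ('i, 'h) km_gen alg_term set complex_algebra" where
  "tilde_algebra sh \<alpha> \<alpha>v = presented_algebra (km_relation sh \<alpha> \<alpha>v)"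

definition tilde_cartan ::
  "(complex \<Rightarrow> 'h \<Rightarrow> 'h) \<Rightarrow> ('i \<Rightarrow> 'h \<Rightarrow> complex) \<Rightarrow> ('i \<Rightarrow> 'h::ab_group_add) \<Rightarrow> 'h \<Rightarrow>
   ('i, 'h) km_gen alg_term set" where
  "tilde_cartan sh \<alpha> \<alpha>v h = presented_rel (km_relation sh \<alpha> \<alpha>v) `` {Gen (H h)}"

text \<open>One-sided closure suffices since the bracket is antisymmetric.\<close>

definition lie_ideal :: "'a complex_algebra \<Rightarrow> 'a set \<Rightarrow> bool" where
  "lie_ideal L I \<longleftrightarrow>
     I \<subseteq> alg_carrier L \<and> alg_zero L \<in> I \<and>
     (\<forall>x\<in>I. \<forall>y\<in>I. alg_add L x y \<in> I) \<and>
     (\<forall>c. \<forall>x\<in>I. alg_smult L c x \<in> I) \<and>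
     (\<forall>x\<in>alg_carrier L. \<forall>y\<in>I. alg_mult L x y \<in> I)"

definition ideal_congruence :: "'a complex_algebra \<Rightarrow> 'a set \<Rightarrow> ('a \<times> 'a) set" where
  "ideal_congruence L I =
     {(x, y). x \<in> alg_carrier L \<and> y \<in> alg_carrier L \<and> alg_add L x (alg_smult L (-1) y) \<in> I}"

definition cartan_trivial_ideal ::
  "(complex \<Rightarrow> 'h \<Rightarrow> 'h) \<Rightarrow> ('i \<Rightarrow> 'h \<Rightarrow> complex) \<Rightarrow> ('i \<Rightarrow> 'h::ab_group_add) \<Rightarrow>
   ('i, 'h) km_gen alg_term set set \<Rightarrow> bool" where
  "cartan_trivial_ideal sh \<alpha> \<alpha>v I \<longleftrightarrow>
     lie_ideal (tilde_algebra sh \<alpha> \<alpha>v) I \<and>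
     I \<inter> range (tilde_cartan sh \<alpha> \<alpha>v) = {alg_zero (tilde_algebra sh \<alpha> \<alpha>v)}"

text \<open>
  Existence and uniqueness of this maximal ideal, hence meaningfulness of the definite
  description, is lemma \<open>km_radical_eq\<close> below.
\<close>

definition km_radical ::
  "(complex \<Rightarrow> 'h \<Rightarrow> 'h) \<Rightarrow> ('i \<Rightarrow> 'h \<Rightarrow> complex) \<Rightarrow> ('i \<Rightarrow> 'h::ab_group_add) \<Rightarrow>
   ('i, 'h) km_gen alg_term set set" where
  "km_radical sh \<alpha> \<alpha>v =
     (THE I. cartan_trivial_ideal sh \<alpha> \<alpha>v I \<and>
             (\<forall>J. cartan_trivial_ideal sh \<alpha> \<alpha>v J \<and> I \<subseteq> J \<longrightarrow> J = I))"

definition kac_moody_algebra ::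
  "(complex \<Rightarrow> 'h \<Rightarrow> 'h) \<Rightarrow> ('i \<Rightarrow> 'h \<Rightarrow> complex) \<Rightarrow> ('i \<Rightarrow> 'h::ab_group_add) \<Rightarrow>
   ('i, 'h) km_gen alg_term set set complex_algebra" where
  "kac_moody_algebra sh \<alpha> \<alpha>v =
     quotient_algebra (tilde_algebra sh \<alpha> \<alpha>v)
       (ideal_congruence (tilde_algebra sh \<alpha> \<alpha>v) (km_radical sh \<alpha> \<alpha>v))"

definition cartan_embedding ::
  "(complex \<Rightarrow> 'h \<Rightarrow> 'h) \<Rightarrow> ('i \<Rightarrow> 'h \<Rightarrow> complex) \<Rightarrow> ('i \<Rightarrow> 'h::ab_group_add) \<Rightarrow> 'h \<Rightarrow>
   ('i, 'h) km_gen alg_term set set" where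
  "cartan_embedding sh \<alpha> \<alpha>v h =
     ideal_congruence (tilde_algebra sh \<alpha> \<alpha>v) (km_radical sh \<alpha> \<alpha>v) `` {tilde_cartan sh \<alpha> \<alpha>v h}"


section \<open>Universal enveloping algebras and modules\<close>

text \<open>The Lie algebra is a type \<open>'a\<close> with scalar multiplication \<open>s\<close> and bracket \<open>br\<close>.\<close>

datatype 'a env_gen = Unit | Incl 'a

inductive env_relation ::
  "(complex \<Rightarrow> 'a \<Rightarrow> 'a) \<Rightarrow> ('a \<Rightarrow> 'a \<Rightarrow> 'a::ab_group_add) \<Rightarrow>
   'a env_gen alg_term \<Rightarrow> 'a env_gen alg_term \<Rightarrow> bool"
  for s br where
  assoc: "env_relation s br (Mult (Mult x y) z) (Mult x (Mult y z))"
| unit_left: "env_relation s br (Mult (Gen Unit) x) x"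
| unit_right: "env_relation s br (Mult x (Gen Unit)) x"
| incl_add: "env_relation s br (Gen (Incl (a + b))) (Add (Gen (Incl a)) (Gen (Incl b)))"
| incl_smult: "env_relation s br (Gen (Incl (s c a))) (Smult c (Gen (Incl a)))"
| incl_bracket: "env_relation s br (Gen (Incl (br a b)))
    (Add (Mult (Gen (Incl a)) (Gen (Incl b))) (Smult (-1) (Mult (Gen (Incl b)) (Gen (Incl a)))))"

definition enveloping_algebra ::
  "(complex \<Rightarrow> 'a \<Rightarrow> 'a) \<Rightarrow> ('a \<Rightarrow> 'a \<Rightarrow> 'a::ab_group_add) \<Rightarrow> 'a env_gen alg_term set complex_algebra" where
  "enveloping_algebra s br = presented_algebra (env_relation s br)"

definition env_incl ::
  "(complex \<Rightarrow> 'a \<Rightarrow> 'a) \<Rightarrow> ('a \<Rightarrow> 'a \<Rightarrow> 'a::ab_group_add) \<Rightarrow> 'a \<Rightarrow> 'a env_gen alg_term set" where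
  "env_incl s br a = presented_rel (env_relation s br) `` {Gen (Incl a)}"

definition lie_module ::
  "'a complex_algebra \<Rightarrow> (complex \<Rightarrow> 'v \<Rightarrow> 'v) \<Rightarrow> ('a \<Rightarrow> 'v \<Rightarrow> 'v::ab_group_add) \<Rightarrow> bool" where
  "lie_module L s \<rho> \<longleftrightarrow>
     vector_space s \<and>
     (\<forall>x\<in>alg_carrier L. Vector_Spaces.linear s s (\<rho> x)) \<and>
     (\<forall>x\<in>alg_carrier L. \<forall>y\<in>alg_carrier L. \<forall>v. \<rho> (alg_add L x y) v = \<rho> x v + \<rho> y v) \<and>
     (\<forall>c. \<forall>x\<in>alg_carrier L. \<forall>v. \<rho> (alg_smult L c x) v = s c (\<rho> x v)) \<and>
     (\<forall>x\<in>alg_carrier L. \<forall>y\<in>alg_carrier L. \<forall>v.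
        \<rho> (alg_mult L x y) v = \<rho> x (\<rho> y v) - \<rho> y (\<rho> x v))"

text \<open>
  An action \<open>\<sigma>\<close> of the abelian Lie algebra \<open>('h, sh)\<close> on \<open>('v, s)\<close> is isomorphic to
  \<open>U('h)\<close> acting on itself by left multiplication.
  As \<open>U('h)\<close> is generated by the image of \<open>'h\<close>, commuting with the action of \<open>'h\<close> is the
  same as being \<open>U('h)\<close>-linear.
\<close>

definition free_rank_one ::
  "(complex \<Rightarrow> 'h \<Rightarrow> 'h::ab_group_add) \<Rightarrow> (complex \<Rightarrow> 'v \<Rightarrow> 'v) \<Rightarrow> ('h \<Rightarrow> 'v \<Rightarrow> 'v::ab_group_add) \<Rightarrow> bool" where
  "free_rank_one sh s \<sigma> \<longleftrightarrow>
     (let U = enveloping_algebra sh (\<lambda>_ _. 0) in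
      \<exists>\<phi>. bij_betw \<phi> UNIV (alg_carrier U) \<and>
          (\<forall>v w. \<phi> (v + w) = alg_add U (\<phi> v) (\<phi> w)) \<and>
          (\<forall>c v. \<phi> (s c v) = alg_smult U c (\<phi> v)) \<and>
          (\<forall>h v. \<phi> (\<sigma> h v) = alg_mult U (env_incl sh (\<lambda>_ _. 0) h) (\<phi> v)))"

text \<open>
  The objects of \<open>\<H>(\<g>)\<close> whose underlying additive group is the type \<open>'v\<close>;
  such an object is a scalar multiplication together with an action of the Lie algebra.
\<close>

definition category_H ::
  "(complex \<Rightarrow> 'h \<Rightarrow> 'h) \<Rightarrow> ('i \<Rightarrow> 'h \<Rightarrow> complex) \<Rightarrow> ('i \<Rightarrow> 'h::ab_group_add) \<Rightarrow>
   ((complex \<Rightarrow> 'v \<Rightarrow> 'v) \<times> (('i, 'h) km_gen alg_term set set \<Rightarrow> 'v \<Rightarrow> 'v::ab_group_add)) set" where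
  "category_H sh \<alpha> \<alpha>v =
     {(s, \<rho>). lie_module (kac_moody_algebra sh \<alpha> \<alpha>v) s \<rho> \<and>
              free_rank_one sh s (\<lambda>h. \<rho> (cartan_embedding sh \<alpha> \<alpha>v h))}"


section \<open>Well-definedness of the maximal ideal\<close>

text \<open>
  \<open>wt d ks\<close> is the product of the operators \<open>ad d - k\<close> for \<open>k\<close> in \<open>ks\<close>. If every simple root
  takes the value 1 at \<open>d\<close>, a suitable such product maps an element of the algebra to a nonzero
  multiple of its component in the Cartan subalgebra (\<open>projects\<close>), so ideals meeting the Cartan
  subalgebra trivially are closed under sums.
\<close>

lemma independent_functionals_surj:
  fixes sh :: "complex \<Rightarrow> 'h::ab_group_add \<Rightarrow> 'h" and f :: "'i \<Rightarrow> 'h \<Rightarrow> complex"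
  assumes vs: "vector_space sh" and lin: "\<And>i. Vector_Spaces.linear sh (*) (f i)"
    and "finite S"
    and "\<And>c. (\<And>h. (\<Sum>i\<in>S. c i * f i h) = 0) \<Longrightarrow> \<forall>i\<in>S. c i = 0"
  shows "\<exists>d. \<forall>i\<in>S. f i d = c i"
  using assms(3,4)
proof (induction S arbitrary: c rule: finite_induct)
  case empty
  then show ?case by simp
next
  case (insert j S)
  interpret vector_space sh by (rule vs)
  have fadd: "f i (x + y) = f i x + f i y" for i x y
    using lin[of i] by (simp add: Vector_Spaces.linear_iff)
  have fsm: "f i (sh a x) = a * f i x" for i a x
    using lin[of i] by (simp add: Vector_Spaces.linear_iff)
  have fsum: "f i (\<Sum>k\<in>S. g k) = (\<Sum>k\<in>S. f i (g k))" for i and g :: "'i \<Rightarrow> 'h"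
  proof (induction S rule: infinite_finite_induct)
    case empty
    show ?case using fsm[of i 0 0] by simp
  next
    case (infinite A)
    show ?case using fsm[of i 0 0] infinite by simp
  qed (simp add: fadd)
  have indS: "\<forall>i\<in>S. c i = 0" if "\<And>h. (\<Sum>i\<in>S. c i * f i h) = 0" for c
  proof -
    have *: "(\<Sum>i\<in>S. (if i \<in> S then c i else 0) * f i h) = (\<Sum>i\<in>S. c i * f i h)" for h
      by (rule sum.cong) auto
    have "\<forall>i\<in>insert j S. (if i \<in> S then c i else 0) = 0"
      by (rule insert.prems) (simp add: insert.hyps that *)
    then show ?thesis by auto
  qed
  have "\<exists>d. \<forall>i\<in>S. f i d = c i" for c
    by (rule insert.IH) (rule indS)
  note IH = this
  define dd where "dd k = (SOME d. \<forall>i\<in>S. f i d = (if i = k then 1 else 0))" for k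
  have dd: "f i (dd k) = (if i = k then 1 else 0)" if "i \<in> S" for i k
    using someI_ex[OF IH[of "\<lambda>i. if i = k then 1 else 0"]] that unfolding dd_def by blast
  have "\<exists>h. f j h \<noteq> (\<Sum>i\<in>S. f j (dd i) * f i h)"
  proof (rule ccontr)
    assume a: "\<not> ?thesis"
    have "\<forall>i\<in>insert j S. (if i = j then -1 else f j (dd i)) = 0"
    proof (rule insert.prems)
      fix h
      have "(\<Sum>i\<in>S. (if i = j then -1 else f j (dd i)) * f i h) = (\<Sum>i\<in>S. f j (dd i) * f i h)"
        using insert.hyps by (intro sum.cong) auto
      then have "(\<Sum>i\<in>insert j S. (if i = j then -1 else f j (dd i)) * f i h) =
          - f j h + (\<Sum>i\<in>S. f j (dd i) * f i h)"
        using insert.hyps by simp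
      moreover have "f j h = (\<Sum>i\<in>S. f j (dd i) * f i h)" using a by blast
      ultimately show "(\<Sum>i\<in>insert j S. (if i = j then -1 else f j (dd i)) * f i h) = 0"
        by (metis left_minus)
    qed
    then show False by auto
  qed
  then obtain h where h: "f j h \<noteq> (\<Sum>i\<in>S. f j (dd i) * f i h)" by blast
  define h' where "h' = h + sh (-1) (\<Sum>i\<in>S. sh (f i h) (dd i))"
  have h'S: "f k h' = 0" if "k \<in> S" for k
    using that insert.hyps unfolding h'_def fadd fsm fsum by (simp add: dd if_distrib cong: if_cong)
  have h'j: "f j h' \<noteq> 0"
    using h unfolding h'_def fadd fsm fsum by (simp add: mult.commute)
  obtain d0 where d0: "\<forall>i\<in>S. f i d0 = c i" using IH by blast
  have "\<forall>i\<in>insert j S. f i (d0 + sh ((c j - f j d0) / f j h') h') = c i"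
    using d0 h'S h'j insert.hyps unfolding fadd fsm by auto
  then show ?case by blast
qed

context
  fixes rel :: "'x alg_term \<Rightarrow> 'x alg_term \<Rightarrow> bool"
begin

lemma equiv_presented_rel: "equiv UNIV (presented_rel rel)"
  unfolding presented_rel_def
  by (rule equivI) (auto simp: refl_on_def sym_def trans_def intro: presented_eq.intros)

lemma presented_class_eq_iff: "presented_rel rel `` {x} = presented_rel rel `` {y} \<longleftrightarrow> presented_eq rel x y"
  using eq_equiv_class_iff[OF equiv_presented_rel, of x y] by (simp add: presented_rel_def)

lemma presented_algebra_simps:
  "alg_carrier (presented_algebra rel) = range (\<lambda>x. presented_rel rel `` {x})"
  "alg_zero (presented_algebra rel) = presented_rel rel `` {Zero}"
  "alg_add (presented_algebra rel) (presented_rel rel `` {x}) (presented_rel rel `` {y}) =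
     presented_rel rel `` {Add x y}"
  "alg_smult (presented_algebra rel) c (presented_rel rel `` {x}) = presented_rel rel `` {Smult c x}"
  "alg_mult (presented_algebra rel) (presented_rel rel `` {x}) (presented_rel rel `` {y}) =
     presented_rel rel `` {Mult x y}"
proof -
  have c2: "(\<Union>x'\<in>presented_rel rel `` {x}. \<Union>y'\<in>presented_rel rel `` {y}. presented_rel rel `` {f x' y'})
      = presented_rel rel `` {f x y}"
    if f: "\<And>x x' y y'. presented_eq rel x x' \<Longrightarrow> presented_eq rel y y' \<Longrightarrow> presented_eq rel (f x y) (f x' y')"
    for f x y
  proof -
    have "presented_rel rel `` {f x' y'} = presented_rel rel `` {f x y}"
      if "x' \<in> presented_rel rel `` {x}" "y' \<in> presented_rel rel `` {y}" for x' y'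
      using that f unfolding presented_class_eq_iff by (auto simp: presented_rel_def intro: presented_eq.sym)
    moreover have "x \<in> presented_rel rel `` {x}" "y \<in> presented_rel rel `` {y}"
      by (auto simp: presented_rel_def intro: presented_eq.refl)
    ultimately show ?thesis by blast
  qed
  show "alg_add (presented_algebra rel) (presented_rel rel `` {x}) (presented_rel rel `` {y}) =
     presented_rel rel `` {Add x y}"
    "alg_mult (presented_algebra rel) (presented_rel rel `` {x}) (presented_rel rel `` {y}) =
     presented_rel rel `` {Mult x y}"
    using c2[of Add] c2[of Mult]
    by (simp_all add: presented_algebra_def quotient_algebra_def term_algebra_def
        presented_eq.cong_add presented_eq.cong_mult)
  have "presented_rel rel `` {Smult c x'} = presented_rel rel `` {Smult c x}"
    if "x' \<in> presented_rel rel `` {x}" for x'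
    using that unfolding presented_class_eq_iff
    by (auto simp: presented_rel_def intro: presented_eq.sym presented_eq.cong_smult)
  moreover have "x \<in> presented_rel rel `` {x}"
    by (auto simp: presented_rel_def intro: presented_eq.refl)
  ultimately have "(\<Union>x'\<in>presented_rel rel `` {x}. presented_rel rel `` {Smult c x'}) = presented_rel rel `` {Smult c x}"
    by (intro UN_constant_eq) blast+
  then show "alg_smult (presented_algebra rel) c (presented_rel rel `` {x}) = presented_rel rel `` {Smult c x}"
    by (simp add: presented_algebra_def quotient_algebra_def term_algebra_def)
qed (auto simp: presented_algebra_def quotient_algebra_def term_algebra_def quotient_def)

end

locale lie_algebra =
  fixes L :: "'a complex_algebra" (structure)
  assumes zero_closed [simp, intro]: "alg_zero L \<in> alg_carrier L"
    and add_closed [simp, intro]: "x \<in> alg_carrier L \<Longrightarrow> y \<in> alg_carrier L \<Longrightarrow> alg_add L x y \<in> alg_carrier L"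
    and smult_closed [simp, intro]: "x \<in> alg_carrier L \<Longrightarrow> alg_smult L c x \<in> alg_carrier L"
    and mult_closed [simp, intro]: "x \<in> alg_carrier L \<Longrightarrow> y \<in> alg_carrier L \<Longrightarrow> alg_mult L x y \<in> alg_carrier L"
    and add_assoc: "x \<in> alg_carrier L \<Longrightarrow> y \<in> alg_carrier L \<Longrightarrow> z \<in> alg_carrier L \<Longrightarrow>
      alg_add L (alg_add L x y) z = alg_add L x (alg_add L y z)"
    and add_comm: "x \<in> alg_carrier L \<Longrightarrow> y \<in> alg_carrier L \<Longrightarrow> alg_add L x y = alg_add L y x"
    and add_zero [simp]: "x \<in> alg_carrier L \<Longrightarrow> alg_add L (alg_zero L) x = x"
    and add_neg: "x \<in> alg_carrier L \<Longrightarrow> alg_add L (alg_smult L (-1) x) x = alg_zero L"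
    and smult_add: "x \<in> alg_carrier L \<Longrightarrow> y \<in> alg_carrier L \<Longrightarrow>
      alg_smult L c (alg_add L x y) = alg_add L (alg_smult L c x) (alg_smult L c y)"
    and add_smult: "x \<in> alg_carrier L \<Longrightarrow>
      alg_smult L (c + d) x = alg_add L (alg_smult L c x) (alg_smult L d x)"
    and smult_smult [simp]: "x \<in> alg_carrier L \<Longrightarrow> alg_smult L c (alg_smult L d x) = alg_smult L (c * d) x"
    and smult_one [simp]: "x \<in> alg_carrier L \<Longrightarrow> alg_smult L 1 x = x"
    and mult_add_left: "x \<in> alg_carrier L \<Longrightarrow> y \<in> alg_carrier L \<Longrightarrow> z \<in> alg_carrier L \<Longrightarrow>
      alg_mult L (alg_add L x y) z = alg_add L (alg_mult L x z) (alg_mult L y z)"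
    and mult_add_right: "x \<in> alg_carrier L \<Longrightarrow> y \<in> alg_carrier L \<Longrightarrow> z \<in> alg_carrier L \<Longrightarrow>
      alg_mult L x (alg_add L y z) = alg_add L (alg_mult L x y) (alg_mult L x z)"
    and mult_smult_left: "x \<in> alg_carrier L \<Longrightarrow> y \<in> alg_carrier L \<Longrightarrow>
      alg_mult L (alg_smult L c x) y = alg_smult L c (alg_mult L x y)"
    and mult_smult_right: "x \<in> alg_carrier L \<Longrightarrow> y \<in> alg_carrier L \<Longrightarrow>
      alg_mult L x (alg_smult L c y) = alg_smult L c (alg_mult L x y)"
    and alternating: "x \<in> alg_carrier L \<Longrightarrow> alg_mult L x x = alg_zero L"
    and jacobi: "x \<in> alg_carrier L \<Longrightarrow> y \<in> alg_carrier L \<Longrightarrow> z \<in> alg_carrier L \<Longrightarrow>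
      alg_add L (alg_mult L x (alg_mult L y z))
        (alg_add L (alg_mult L y (alg_mult L z x)) (alg_mult L z (alg_mult L x y))) = alg_zero L"

lemma lie_algebra_tilde: "lie_algebra (tilde_algebra sh \<alpha> \<alpha>v)"
  unfolding tilde_algebra_def
  by (unfold_locales; clarsimp simp: presented_algebra_simps presented_class_eq_iff;
      (rule rangeI)?; (rule presented_eq.intros(8-))?; (rule presented_eq.relation, rule km_relation.intros)?)

context lie_algebra
begin

abbreviation pl (infixl "\<oplus>" 65) where "x \<oplus> y \<equiv> alg_add L x y"
abbreviation sm (infixr "\<odot>" 75) where "c \<odot> x \<equiv> alg_smult L c x"
abbreviation br where "br x y \<equiv> alg_mult L x y"
abbreviation ze ("\<zero>") where "\<zero> \<equiv> alg_zero L"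
abbreviation C where "C \<equiv> alg_carrier L"

lemma add_left_comm: "x \<in> C \<Longrightarrow> y \<in> C \<Longrightarrow> z \<in> C \<Longrightarrow> x \<oplus> (y \<oplus> z) = y \<oplus> (x \<oplus> z)"
  by (metis add_assoc add_comm)

lemma add_zero_right [simp]: "x \<in> C \<Longrightarrow> x \<oplus> \<zero> = x"
  by (metis add_comm add_zero zero_closed)

lemma add_cancel: "x \<in> C \<Longrightarrow> y \<in> C \<Longrightarrow> z \<in> C \<Longrightarrow> x \<oplus> y = x \<oplus> z \<longleftrightarrow> y = z"
  by (metis add_assoc add_neg add_zero smult_closed)

lemma smult_zero_left [simp]: "x \<in> C \<Longrightarrow> 0 \<odot> x = \<zero>"
  by (metis add_cancel add_smult add_zero_right add_0 smult_closed zero_closed)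

lemma smult_zero_right [simp]: "c \<odot> \<zero> = \<zero>"
  by (metis smult_zero_left smult_smult zero_closed mult_zero_right)

lemma mult_zero_right [simp]: "x \<in> C \<Longrightarrow> br x \<zero> = \<zero>"
  by (metis mult_smult_right smult_zero_left zero_closed mult_closed)

lemma mult_zero_left [simp]: "x \<in> C \<Longrightarrow> br \<zero> x = \<zero>"
  by (metis mult_smult_left smult_zero_left zero_closed mult_closed)

lemma add_eq_zero: "x \<in> C \<Longrightarrow> y \<in> C \<Longrightarrow> x \<oplus> y = \<zero> \<Longrightarrow> x = (-1) \<odot> y"
  by (metis add_cancel add_comm add_neg smult_closed)

lemma add_right_neg: "x \<in> C \<Longrightarrow> x \<oplus> (-1) \<odot> x = \<zero>"
  by (metis add_comm add_neg smult_closed)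

lemma anticommute:
  assumes "x \<in> C" "y \<in> C"
  shows "br x y = (-1) \<odot> br y x"
proof -
  have "br (x \<oplus> y) (x \<oplus> y) = \<zero>" using assms alternating by blast
  also have "br (x \<oplus> y) (x \<oplus> y) = br x y \<oplus> br y x"
    using assms by (subst mult_add_left) (simp_all add: mult_add_right alternating)
  finally have "br x y \<oplus> br y x = \<zero>" .
  then show ?thesis using assms by (intro add_eq_zero) auto
qed

lemma leibniz:
  assumes "x \<in> C" "y \<in> C" "z \<in> C"
  shows "br x (br y z) = br (br x y) z \<oplus> br y (br x z)"
proof -
  have "br x (br y z) \<oplus> (br y (br z x) \<oplus> br z (br x y)) = \<zero>"
    using jacobi assms by blast
  moreover have "br y (br z x) = (-1) \<odot> br y (br x z)"
    using assms by (subst anticommute[of z x]) (auto simp: mult_smult_right)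
  moreover have "br z (br x y) = (-1) \<odot> br (br x y) z"
    using assms by (subst anticommute) auto
  ultimately have "br x (br y z) = (-1) \<odot> ((-1) \<odot> br y (br x z) \<oplus> (-1) \<odot> br (br x y) z)"
    using assms by (intro add_eq_zero) auto
  then show ?thesis using assms by (simp add: smult_add add_comm)
qed

fun wt :: "'a \<Rightarrow> complex list \<Rightarrow> 'a \<Rightarrow> 'a" where
  "wt d [] x = x"
| "wt d (k # ks) x = br d (wt d ks x) \<oplus> (- k) \<odot> wt d ks x"

lemma wt_closed [simp]: "d \<in> C \<Longrightarrow> x \<in> C \<Longrightarrow> wt d ks x \<in> C"
  by (induction ks) auto

lemma wt_append: "wt d (ks @ ls) x = wt d ks (wt d ls x)"
  by (induction ks) auto

lemma wt_add: "d \<in> C \<Longrightarrow> x \<in> C \<Longrightarrow> y \<in> C \<Longrightarrow> wt d ks (x \<oplus> y) = wt d ks x \<oplus> wt d ks y"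
  by (induction ks) (auto simp: mult_add_right smult_add add_assoc add_left_comm)

lemma wt_smult: "d \<in> C \<Longrightarrow> x \<in> C \<Longrightarrow> wt d ks (c \<odot> x) = c \<odot> wt d ks x"
  by (induction ks) (auto simp: mult_smult_right smult_add mult.commute)

lemma wt_zero [simp]: "d \<in> C \<Longrightarrow> wt d ks \<zero> = \<zero>"
  by (induction ks) auto

lemma wt_br: "d \<in> C \<Longrightarrow> x \<in> C \<Longrightarrow> br d (wt d ks x) = wt d ks (br d x)"
  by (induction ks) (auto simp: mult_add_right mult_smult_right)

lemma wt_comm: "d \<in> C \<Longrightarrow> x \<in> C \<Longrightarrow> wt d ks (wt d ls x) = wt d ls (wt d ks x)"
  by (induction ks) (auto simp: wt_add wt_smult wt_br)

lemma wt_eigen: "d \<in> C \<Longrightarrow> x \<in> C \<Longrightarrow> br d x = \<zero> \<Longrightarrow> wt d ks x = (\<Prod>k\<leftarrow>ks. - k) \<odot> x"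
  by (induction ks) (auto simp: mult_smult_right)

lemma wt_ideal: "lie_ideal L I \<Longrightarrow> d \<in> C \<Longrightarrow> x \<in> I \<Longrightarrow> wt d ks x \<in> I"
  by (induction ks) (auto simp: lie_ideal_def)

lemma ideal_sum:
  assumes "lie_ideal L I" "lie_ideal L J"
  shows "lie_ideal L {x \<oplus> y | x y. x \<in> I \<and> y \<in> J}"
proof -
  have I: "x \<in> C" if "x \<in> I" for x using assms that by (auto simp: lie_ideal_def)
  have J: "x \<in> C" if "x \<in> J" for x using assms that by (auto simp: lie_ideal_def)
  let ?K = "{x \<oplus> y | x y. x \<in> I \<and> y \<in> J}"
  have K: "x \<oplus> y \<in> ?K" if "x \<in> I" "y \<in> J" for x y using that by blast
  show ?thesis
    unfolding lie_ideal_def[of L ?K]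
  proof (intro conjI ballI allI)
    show "?K \<subseteq> C" using I J by blast
    show "\<zero> \<in> ?K" using K[of \<zero> \<zero>] assms by (simp add: lie_ideal_def)
  next
    fix p q assume "p \<in> ?K" "q \<in> ?K"
    then obtain x y x' y' where *: "p = x \<oplus> y" "q = x' \<oplus> y'" "x \<in> I" "x' \<in> I" "y \<in> J" "y' \<in> J"
      by blast
    have "p \<oplus> q = (x \<oplus> x') \<oplus> (y \<oplus> y')"
      using * I J by (simp add: add_assoc add_left_comm)
    moreover have "x \<oplus> x' \<in> I" "y \<oplus> y' \<in> J"
      using * assms by (auto simp: lie_ideal_def)
    ultimately show "p \<oplus> q \<in> ?K" using K by simp
  next
    fix c p assume "p \<in> ?K"
    then obtain x y where *: "p = x \<oplus> y" "x \<in> I" "y \<in> J" by blast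
    moreover have "c \<odot> x \<in> I" "c \<odot> y \<in> J" using * assms by (auto simp: lie_ideal_def)
    ultimately show "c \<odot> p \<in> ?K" using K I J by (simp add: smult_add)
  next
    fix w p assume w: "w \<in> C" and "p \<in> ?K"
    then obtain x y where *: "p = x \<oplus> y" "x \<in> I" "y \<in> J" by blast
    moreover have "br w x \<in> I" "br w y \<in> J" using w * assms by (auto simp: lie_ideal_def)
    ultimately show "br w p \<in> ?K" using K I J w by (simp add: mult_add_right)
  qed
qed

end

inductive graded :: "'a complex_algebra \<Rightarrow> ('i \<Rightarrow> 'a) \<Rightarrow> ('h \<Rightarrow> 'a) \<Rightarrow> nat \<Rightarrow> 'a \<Rightarrow> bool"
  for L e \<iota> where
  cartan: "graded L e \<iota> 0 (\<iota> h)"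
| gen: "graded L e \<iota> 1 (e i)"
| bracket: "graded L e \<iota> k x \<Longrightarrow> graded L e \<iota> (Suc k) (alg_mult L (e i) x)"
| add: "graded L e \<iota> k x \<Longrightarrow> graded L e \<iota> k y \<Longrightarrow> graded L e \<iota> k (alg_add L x y)"
| smult: "graded L e \<iota> k x \<Longrightarrow> graded L e \<iota> k (alg_smult L c x)"

locale chevalley = lie_algebra L
  for L :: "'a complex_algebra" (structure) +
  fixes sh :: "complex \<Rightarrow> 'h::ab_group_add \<Rightarrow> 'h" and \<alpha> :: "'i \<Rightarrow> 'h \<Rightarrow> complex" and \<alpha>v :: "'i \<Rightarrow> 'h"
    and e f :: "'i \<Rightarrow> 'a" and \<iota> :: "'h \<Rightarrow> 'a"
  assumes ec [simp]: "e i \<in> C" and fc [simp]: "f i \<in> C" and \<iota>c [simp]: "\<iota> h \<in> C"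
    and \<iota>_add: "\<iota> (h + h') = \<iota> h \<oplus> \<iota> h'" and \<iota>_smult: "\<iota> (sh c h) = c \<odot> \<iota> h"
    and \<iota>_comm: "br (\<iota> h) (\<iota> h') = \<zero>"
    and \<iota>_e: "br (\<iota> h) (e i) = \<alpha> i h \<odot> e i"
    and \<iota>_f: "br (\<iota> h) (f i) = (- \<alpha> i h) \<odot> f i"
    and ef: "br (e i) (f j) = (if i = j then \<iota> (\<alpha>v i) else \<zero>)"
begin

abbreviation "G \<equiv> graded L e \<iota>"
abbreviation "G' \<equiv> graded L f \<iota>"

lemma G_closed: "G k x \<Longrightarrow> x \<in> C"
  by (induction rule: graded.induct) auto

lemma \<iota>_zero: "\<iota> 0 = \<zero>"
proof -
  have "\<iota> 0 \<oplus> \<iota> 0 = \<iota> 0 \<oplus> \<zero>" using \<iota>_add[of 0 0] by simp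
  then show ?thesis by (subst (asm) add_cancel) auto
qed

lemma G0: "G k x \<Longrightarrow> k = 0 \<Longrightarrow> x \<in> range \<iota>"
  by (induction rule: graded.induct) (auto simp: \<iota>_add[symmetric] \<iota>_smult[symmetric])

lemma e_\<iota>: "br (e i) (\<iota> h) = (- \<alpha> i h) \<odot> e i"
  by (subst anticommute) (simp_all add: \<iota>_e)

lemma f_\<iota>: "br (f i) (\<iota> h) = \<alpha> i h \<odot> f i"
  by (subst anticommute) (simp_all add: \<iota>_f)

lemma fe: "br (f i) (e j) = (if i = j then \<iota> (sh (-1) (\<alpha>v i)) else \<zero>)"
  by (subst anticommute) (simp_all add: ef \<iota>_smult)

lemma G_zero: "G 0 \<zero>"
  using graded.cartan[of L e \<iota> 0] by (simp add: \<iota>_zero)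

lemma G_\<iota>: "G k x \<Longrightarrow> G k (br (\<iota> h) x)"
proof (induction rule: graded.induct)
  case (cartan h') show ?case by (simp add: \<iota>_comm G_zero)
next
  case (gen i) show ?case unfolding \<iota>_e by (intro graded.smult graded.gen)
next
  case (bracket k x i)
  note x = G_closed[OF bracket.hyps]
  have "br (\<iota> h) (br (e i) x) = \<alpha> i h \<odot> br (e i) x \<oplus> br (e i) (br (\<iota> h) x)"
    using x by (subst leibniz) (simp_all add: \<iota>_e mult_smult_left)
  then show ?case using bracket by (auto intro: graded.intros)
next
  case (add k x y)
  then show ?case by (simp add: mult_add_right G_closed graded.add)
next
  case (smult k x c)
  then show ?case by (simp add: mult_smult_right G_closed graded.smult)
qed

lemma G_degree: 
  assumes d: "\<And>i. \<alpha> i d = t"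
  shows "G k x \<Longrightarrow> br (\<iota> d) x = (of_nat k * t) \<odot> x"
proof (induction rule: graded.induct)
  case (bracket k x i)
  note x = G_closed[OF bracket.hyps]
  have "br (\<iota> d) (br (e i) x) = t \<odot> br (e i) x \<oplus> (of_nat k * t) \<odot> br (e i) x"
    using x by (subst leibniz) (simp_all add: \<iota>_e d mult_smult_left mult_smult_right bracket.IH)
  then show ?case using x by (simp add: add_smult[symmetric] algebra_simps)
qed (simp_all add: \<iota>_comm \<iota>_e d mult_add_right mult_smult_right smult_add G_closed mult.commute)

lemma G_f: "G k x \<Longrightarrow> k = Suc m \<Longrightarrow> G m (br (f j) x)"
proof (induction arbitrary: m rule: graded.induct)
  case (gen i)
  then show ?case using G_zero by (auto simp: fe intro: graded.intros)
next
  case (bracket k x i)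
  note x = G_closed[OF bracket.hyps]
  have 1: "br (f j) (br (e i) x) = br (br (f j) (e i)) x \<oplus> br (e i) (br (f j) x)"
    using x by (subst leibniz) simp_all
  have z: "G k \<zero>" using graded.smult[OF bracket.hyps, of 0] x by simp
  have 2: "G k (br (br (f j) (e i)) x)"
    using x z by (auto simp: fe intro: G_\<iota> bracket.hyps)
  have 3: "G k (br (e i) (br (f j) x))"
  proof (cases k)
    case 0
    then obtain h where "x = \<iota> h" using G0[OF bracket.hyps] by auto
    then have "br (e i) (br (f j) x) = \<alpha> j h \<odot> br (e i) (f j)"
      by (simp add: f_\<iota> mult_smult_right)
    then show ?thesis using 0 G_zero by (auto simp: ef intro: graded.intros)
  next
    case (Suc n)
    then show ?thesis using bracket.IH by (auto intro: graded.bracket)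
  qed
  show ?case using bracket.prems 1 2 3 by (auto intro: graded.add)
qed (auto simp: mult_add_right mult_smult_right G_closed intro: graded.intros)

end

lemma chevalley_flip:
  assumes "chevalley L sh \<alpha> \<alpha>v e f \<iota>"
  shows "chevalley L sh (\<lambda>i h. - \<alpha> i h) (\<lambda>i. sh (-1) (\<alpha>v i)) f e \<iota>"
proof -
  interpret chevalley L sh \<alpha> \<alpha>v e f \<iota> by (rule assms)
  show ?thesis by unfold_locales (auto simp: \<iota>_add \<iota>_smult \<iota>_comm \<iota>_e \<iota>_f fe)
qed

inductive tri :: "'a complex_algebra \<Rightarrow> ('i \<Rightarrow> 'a) \<Rightarrow> ('i \<Rightarrow> 'a) \<Rightarrow> ('h \<Rightarrow> 'a) \<Rightarrow> 'a \<Rightarrow> bool"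
  for L e f \<iota> where
  pos: "graded L e \<iota> k x \<Longrightarrow> tri L e f \<iota> x"
| neg: "graded L f \<iota> k x \<Longrightarrow> tri L e f \<iota> x"
| add: "tri L e f \<iota> x \<Longrightarrow> tri L e f \<iota> y \<Longrightarrow> tri L e f \<iota> (alg_add L x y)"

context chevalley
begin

interpretation flip: chevalley L sh "\<lambda>i h. - \<alpha> i h" "\<lambda>i. sh (-1) (\<alpha>v i)" f e \<iota>
  by (rule chevalley_flip) unfold_locales

abbreviation "T \<equiv> tri L e f \<iota>"

lemma T_closed: "T x \<Longrightarrow> x \<in> C"
  by (induction rule: tri.induct) (auto simp: G_closed flip.G_closed)

lemma T_smult: "T x \<Longrightarrow> T (c \<odot> x)"
  by (induction rule: tri.induct) (auto simp: smult_add T_closed intro: tri.intros graded.smult)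

lemma T_zero: "T \<zero>"
  using G_zero by (rule tri.pos)

lemma T_\<iota>: "T x \<Longrightarrow> T (br (\<iota> h) x)"
  by (induction rule: tri.induct)
    (auto simp: mult_add_right T_closed intro: tri.intros G_\<iota> flip.G_\<iota>)

lemma T_e: "T x \<Longrightarrow> T (br (e i) x)"
proof (induction rule: tri.induct)
  case (pos k x)
  then show ?case by (auto intro: tri.intros graded.intros)
next
  case (neg k x)
  show ?case
  proof (cases k)
    case 0
    then obtain h where "x = \<iota> h" using flip.G0[OF neg] by auto
    then show ?thesis by (auto simp: e_\<iota> intro: tri.pos graded.intros)
  next
    case (Suc m)
    then show ?thesis using flip.G_f[OF neg] by (auto intro: tri.neg)
  qed
qed (simp add: mult_add_right T_closed tri.add)

lemma T_f: "T x \<Longrightarrow> T (br (f i) x)"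
proof (induction rule: tri.induct)
  case (neg k x)
  then show ?case by (auto intro: tri.intros graded.intros)
next
  case (pos k x)
  show ?case
  proof (cases k)
    case 0
    then obtain h where "x = \<iota> h" using G0[OF pos] by auto
    then show ?thesis by (auto simp: f_\<iota> intro: tri.neg graded.intros)
  next
    case (Suc m)
    then show ?thesis using G_f[OF pos] by (auto intro: tri.pos)
  qed
qed (simp add: mult_add_right T_closed tri.add)

definition projects :: "'h \<Rightarrow> 'a \<Rightarrow> 'h \<Rightarrow> bool" where
  "projects d x h \<longleftrightarrow> x \<in> C \<and> (\<exists>ks. 0 \<notin> set ks \<and> wt (\<iota> d) ks x = (\<Prod>k\<leftarrow>ks. - k) \<odot> \<iota> h)"

lemma projects_\<iota>: "projects d (\<iota> h) h"
  unfolding projects_def by (auto intro!: exI[of _ "[]"])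

lemma projects_add:
  assumes "projects d x h" "projects d y h'"
  shows "projects d (x \<oplus> y) (h + h')"
proof -
  obtain ks ls where ks: "0 \<notin> set ks" "wt (\<iota> d) ks x = (\<Prod>k\<leftarrow>ks. - k) \<odot> \<iota> h"
    and ls: "0 \<notin> set ls" "wt (\<iota> d) ls y = (\<Prod>k\<leftarrow>ls. - k) \<odot> \<iota> h'"
    and xy: "x \<in> C" "y \<in> C"
    using assms unfolding projects_def by blast
  have "wt (\<iota> d) (ks @ ls) x = (\<Prod>k\<leftarrow>ks @ ls. - k) \<odot> \<iota> h"
    using xy by (simp add: wt_append wt_comm[of "\<iota> d" x ks ls] ks wt_smult wt_eigen \<iota>_comm)
  moreover have "wt (\<iota> d) (ks @ ls) y = (\<Prod>k\<leftarrow>ks @ ls. - k) \<odot> \<iota> h'"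
    using xy by (simp add: wt_append ls wt_smult wt_eigen \<iota>_comm mult.commute)
  ultimately have "wt (\<iota> d) (ks @ ls) (x \<oplus> y) = (\<Prod>k\<leftarrow>ks @ ls. - k) \<odot> \<iota> (h + h')"
    using xy by (simp only: wt_add \<iota>c \<iota>_add smult_add)
  then show ?thesis
    using ks(1) ls(1) xy unfolding projects_def
    by (intro conjI exI[of _ "ks @ ls"]) auto
qed

lemma projects_eigen:
  assumes "x \<in> C" "br (\<iota> d) x = k \<odot> x" "k \<noteq> 0"
  shows "projects d x 0"
proof -
  have "wt (\<iota> d) [k] x = \<zero>" using assms by (simp add: add_smult[symmetric])
  then show ?thesis using assms unfolding projects_def
    by (intro conjI exI[of _ "[k]"]) (auto simp: \<iota>_zero)
qed

lemma T_projects: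
  assumes d: "\<And>i. \<alpha> i d = 1"
  shows "T x \<Longrightarrow> \<exists>h. projects d x h"
proof (induction rule: tri.induct)
  case (pos k x)
  show ?case
  proof (cases "k = 0")
    case True
    then show ?thesis using G0[OF pos] projects_\<iota> by auto
  next
    case False
    then show ?thesis using G_degree[OF d pos] G_closed[OF pos]
      by (intro exI[of _ 0] projects_eigen[where k = "of_nat k"]) auto
  qed
next
  case (neg k x)
  have d': "- \<alpha> i d = -1" for i using d by simp
  show ?case
  proof (cases "k = 0")
    case True
    then show ?thesis using flip.G0[OF neg] projects_\<iota> by auto
  next
    case False
    then show ?thesis using flip.G_degree[OF d' neg] flip.G_closed[OF neg]
      by (intro exI[of _ 0] projects_eigen[where k = "- of_nat k"]) auto
  qed
qed (auto intro: projects_add)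

definition triv :: "'a set \<Rightarrow> bool" where
  "triv I \<longleftrightarrow> lie_ideal L I \<and> I \<inter> range \<iota> = {\<zero>}"

lemma smult_nz: "x \<in> C \<Longrightarrow> c \<odot> x = \<zero> \<Longrightarrow> c \<noteq> 0 \<Longrightarrow> x = \<zero>"
  by (metis smult_smult smult_one smult_zero_right left_inverse)

lemma triv_projects:
  assumes "triv I" "x \<in> I" "projects d x h"
  shows "\<iota> h = \<zero>"
proof -
  obtain ks where ks: "0 \<notin> set ks" "wt (\<iota> d) ks x = (\<Prod>k\<leftarrow>ks. - k) \<odot> \<iota> h"
    using assms unfolding projects_def by blast
  have "wt (\<iota> d) ks x \<in> I" using assms wt_ideal unfolding triv_def by simp
  then have "\<iota> (sh (\<Prod>k\<leftarrow>ks. - k) h) \<in> I \<inter> range \<iota>" unfolding ks(2) \<iota>_smult[symmetric] by blast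
  then have "(\<Prod>k\<leftarrow>ks. - k) \<odot> \<iota> h = \<zero>" using assms \<iota>_smult unfolding triv_def by auto
  moreover have "(\<Prod>k\<leftarrow>ks. - k) \<noteq> 0" using ks(1) by (induction ks) auto
  ultimately show ?thesis using smult_nz by simp
qed

lemma projects_unique_zero:
  assumes "projects d (\<iota> h) h'" shows "\<iota> h = \<iota> h'"
proof -
  obtain ks where ks: "0 \<notin> set ks" "wt (\<iota> d) ks (\<iota> h) = (\<Prod>k\<leftarrow>ks. - k) \<odot> \<iota> h'"
    using assms unfolding projects_def by blast
  have nz: "(\<Prod>k\<leftarrow>ks. - k) \<noteq> 0" using ks(1) by (induction ks) auto
  have "(\<Prod>k\<leftarrow>ks. - k) \<odot> \<iota> h = (\<Prod>k\<leftarrow>ks. - k) \<odot> \<iota> h'"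
    using ks(2) by (simp add: wt_eigen \<iota>_comm)
  then have "inverse (\<Prod>k\<leftarrow>ks. - k) \<odot> (\<Prod>k\<leftarrow>ks. - k) \<odot> \<iota> h
    = inverse (\<Prod>k\<leftarrow>ks. - k) \<odot> (\<Prod>k\<leftarrow>ks. - k) \<odot> \<iota> h'" by simp
  then show ?thesis using nz by simp
qed

lemma triv_sum:
  assumes all: "\<And>x. x \<in> C \<Longrightarrow> T x" and d: "\<And>i. \<alpha> i d = 1" and I: "triv I" and J: "triv J"
  shows "triv {x \<oplus> y | x y. x \<in> I \<and> y \<in> J}"
  unfolding triv_def
proof (intro conjI equalityI subsetI)
  show "lie_ideal L {x \<oplus> y | x y. x \<in> I \<and> y \<in> J}"
    using I J ideal_sum unfolding triv_def by blast
next
  fix z assume "z \<in> {x \<oplus> y | x y. x \<in> I \<and> y \<in> J} \<inter> range \<iota>"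
  then obtain h x y where *: "\<iota> h = x \<oplus> y" "z = \<iota> h" "x \<in> I" "y \<in> J" by auto
  have "x \<in> C" "y \<in> C" using * I J unfolding triv_def lie_ideal_def by auto
  then obtain h1 h2 where p: "projects d x h1" "projects d y h2"
    using T_projects[OF d] all by metis
  have "\<iota> h1 = \<zero>" "\<iota> h2 = \<zero>" using p * I J triv_projects by blast+
  moreover have "\<iota> h = \<iota> (h1 + h2)"
    using projects_add[OF p] *(1) by (intro projects_unique_zero) simp
  ultimately show "z \<in> {\<zero>}" using * by (simp add: \<iota>_add)
next
  fix z assume "z \<in> {\<zero>}"
  moreover have "\<zero> \<in> I" "\<zero> \<in> J" "\<zero> \<in> range \<iota>" "\<zero> = \<zero> \<oplus> \<zero>"
    using I J unfolding triv_def by auto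
  ultimately show "z \<in> {x \<oplus> y | x y. x \<in> I \<and> y \<in> J} \<inter> range \<iota>" by blast
qed

lemma greatest_triv:
  assumes all: "\<And>x. x \<in> C \<Longrightarrow> T x" and d: "\<And>i. \<alpha> i d = 1"
  shows "triv (\<Union>{I. triv I})"
proof -
  let ?R = "\<Union>{I. triv I}"
  have "lie_ideal L {\<zero>}" by (auto simp: lie_ideal_def)
  moreover have "\<zero> \<in> range \<iota>" using \<iota>_zero by (metis rangeI)
  ultimately have t0: "triv {\<zero>}" by (auto simp: triv_def)
  have pl: "x \<oplus> y \<in> ?R" if xy: "x \<in> ?R" "y \<in> ?R" for x y
  proof -
    obtain I J where "triv I" "x \<in> I" "triv J" "y \<in> J" using xy by blast
    then show ?thesis using triv_sum[OF all d, of I J] by blast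
  qed
  have "lie_ideal L ?R"
    unfolding lie_ideal_def
  proof (intro conjI ballI allI)
    show "\<zero> \<in> ?R" using t0 by blast
    show "?R \<subseteq> C" by (auto simp: triv_def lie_ideal_def)
  next
    fix x y assume "x \<in> ?R" "y \<in> ?R"
    then show "x \<oplus> y \<in> ?R" by (rule pl)
  next
    fix c x assume "x \<in> ?R"
    then obtain I where "triv I" "x \<in> I" by blast
    moreover from this have "c \<odot> x \<in> I" by (simp add: triv_def lie_ideal_def)
    ultimately show "c \<odot> x \<in> ?R" by blast
  next
    fix w x assume "w \<in> C" "x \<in> ?R"
    then obtain I where "triv I" "x \<in> I" by blast
    moreover from this \<open>w \<in> C\<close> have "br w x \<in> I" by (simp add: triv_def lie_ideal_def)
    ultimately show "br w x \<in> ?R" by blast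
  qed
  then show ?thesis using t0 unfolding triv_def by blast
qed

end

lemma chevalley_tilde:
  "chevalley (tilde_algebra sh \<alpha> \<alpha>v) sh \<alpha> \<alpha>v
     (\<lambda>i. presented_rel (km_relation sh \<alpha> \<alpha>v) `` {Gen (E i)})
     (\<lambda>i. presented_rel (km_relation sh \<alpha> \<alpha>v) `` {Gen (F i)}) (tilde_cartan sh \<alpha> \<alpha>v)"
  (is "chevalley ?L sh \<alpha> \<alpha>v ?e ?f ?\<iota>")
proof -
  interpret lie_algebra ?L by (rule lie_algebra_tilde)
  have ax: "chevalley_axioms ?L sh \<alpha> \<alpha>v ?e ?f ?\<iota>"
  proof (unfold_locales, goal_cases)
    case (9 i j)
    show ?case using km_relation.e_f[of sh \<alpha> \<alpha>v i j]
      by (auto simp: tilde_cartan_def tilde_algebra_def presented_algebra_simps presented_class_eq_iff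
          split: if_splits intro: presented_eq.relation)
  qed (simp_all add: tilde_cartan_def tilde_algebra_def presented_algebra_simps presented_class_eq_iff
      presented_eq.relation km_relation.intros, (rule rangeI)+)
  show ?thesis by (rule chevalley.intro[OF lie_algebra_tilde ax])
qed

lemma tri_tilde:
  fixes sh \<alpha> \<alpha>v
  defines "cl \<equiv> \<lambda>t. presented_rel (km_relation sh \<alpha> \<alpha>v) `` {t}"
  assumes "x \<in> alg_carrier (tilde_algebra sh \<alpha> \<alpha>v)"
  shows "tri (tilde_algebra sh \<alpha> \<alpha>v) (\<lambda>i. cl (Gen (E i))) (\<lambda>i. cl (Gen (F i))) (tilde_cartan sh \<alpha> \<alpha>v) x"
proof -
  let ?L = "tilde_algebra sh \<alpha> \<alpha>v"
  let ?b = "alg_mult ?L"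
  let ?T = "tri ?L (\<lambda>i. cl (Gen (E i))) (\<lambda>i. cl (Gen (F i))) (tilde_cartan sh \<alpha> \<alpha>v)"
  have cl: "cl Zero = alg_zero ?L" "cl (Add s t) = alg_add ?L (cl s) (cl t)" "cl (Smult c t) = alg_smult ?L c (cl t)"
    "cl (Mult s t) = ?b (cl s) (cl t)" "cl t \<in> alg_carrier ?L" "cl (Gen (H h)) = tilde_cartan sh \<alpha> \<alpha>v h" for s t c h
    unfolding cl_def tilde_algebra_def tilde_cartan_def presented_algebra_simps by (rule HOL.refl rangeI)+
  interpret chevalley "tilde_algebra sh \<alpha> \<alpha>v" sh \<alpha> \<alpha>v
    "\<lambda>i. cl (Gen (E i))" "\<lambda>i. cl (Gen (F i))" "tilde_cartan sh \<alpha> \<alpha>v"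
    unfolding cl_def by (rule chevalley_tilde)
  have ad: "?T y \<Longrightarrow> ?T (?b (cl t) y)" for t y
  proof (induction t arbitrary: y)
    case (Gen g)
    then show ?case by (cases g) (auto simp: cl(6) intro: T_e T_f T_\<iota>)
  next
    case Zero
    then show ?case by (simp add: cl T_closed T_zero)
  next
    case (Add s t)
    then show ?case by (simp add: cl T_closed mult_add_left tri.add)
  next
    case (Smult c t)
    then show ?case by (simp add: cl T_closed mult_smult_left T_smult)
  next
    case (Mult s t)
    have y: "y \<in> alg_carrier ?L" using Mult.prems by (rule T_closed)
    have "?b (cl s) (?b (cl t) y) = alg_add ?L (?b (?b (cl s) (cl t)) y) (?b (cl t) (?b (cl s) y))"
      using y by (intro leibniz) (auto simp: cl)
    then have "?b (cl (Mult s t)) y = alg_add ?L (?b (cl s) (?b (cl t) y)) (alg_smult ?L (-1) (?b (cl t) (?b (cl s) y)))"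
      using y by (simp add: cl(4,5) add_assoc add_right_neg)
    moreover have "?T (?b (cl s) (?b (cl t) y))" "?T (?b (cl t) (?b (cl s) y))"
      using Mult by blast+
    ultimately show ?case by (auto intro: tri.add T_smult)
  qed
  have "?T (cl t)" for t
  proof (induction t)
    case (Gen g)
    show ?case
    proof (cases g)
      case (E i)
      then show ?thesis by (auto intro: tri.pos graded.gen)
    next
      case (F i)
      then show ?thesis by (auto intro: tri.neg graded.gen)
    next
      case (H h)
      then show ?thesis by (auto simp: cl(6) intro: tri.pos graded.cartan)
    qed
  qed (auto simp: cl(1-4) intro: T_zero tri.add T_smult ad)
  moreover obtain t where "x = cl t"
    using assms(2) by (auto simp: cl_def tilde_algebra_def presented_algebra_simps)
  ultimately show ?thesis by simp
qed

lemma greatest_cartan_trivial_ideal: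
  fixes A :: "int^'i^'i" and \<alpha>v :: "'i \<Rightarrow> 'h::ab_group_add"
  assumes "realization A sh \<alpha> \<alpha>v"
  shows "cartan_trivial_ideal sh \<alpha> \<alpha>v (\<Union>{I. cartan_trivial_ideal sh \<alpha> \<alpha>v I})"
proof -
  interpret chevalley "tilde_algebra sh \<alpha> \<alpha>v" sh \<alpha> \<alpha>v
    "\<lambda>i. presented_rel (km_relation sh \<alpha> \<alpha>v) `` {Gen (E i)}"
    "\<lambda>i. presented_rel (km_relation sh \<alpha> \<alpha>v) `` {Gen (F i)}" "tilde_cartan sh \<alpha> \<alpha>v"
    by (rule chevalley_tilde)
  have "\<exists>d. \<forall>i\<in>UNIV. \<alpha> i d = 1"
    using assms unfolding realization_def
    by (intro independent_functionals_surj[of sh]) (auto simp: finite_dimensional_vector_space_def)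
  then obtain d where d: "\<alpha> i d = 1" for i by auto
  have "triv = cartan_trivial_ideal sh \<alpha> \<alpha>v"
    by (intro ext) (simp add: triv_def cartan_trivial_ideal_def)
  then show ?thesis using greatest_triv[OF tri_tilde d] by simp
qed

lemma km_radical_eq:
  fixes A :: "int^'i^'i" and \<alpha>v :: "'i \<Rightarrow> 'h::ab_group_add"
  assumes "realization A sh \<alpha> \<alpha>v"
  shows "km_radical sh \<alpha> \<alpha>v = \<Union>{I. cartan_trivial_ideal sh \<alpha> \<alpha>v I}"
  unfolding km_radical_def
proof (rule the_equality, intro conjI allI impI)
  show "cartan_trivial_ideal sh \<alpha> \<alpha>v (\<Union>{I. cartan_trivial_ideal sh \<alpha> \<alpha>v I})"
    using assms by (rule greatest_cartan_trivial_ideal)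
next
  fix J assume J: "cartan_trivial_ideal sh \<alpha> \<alpha>v J \<and> \<Union>{I. cartan_trivial_ideal sh \<alpha> \<alpha>v I} \<subseteq> J"
  show "J = \<Union>{I. cartan_trivial_ideal sh \<alpha> \<alpha>v I}" using J by blast
next
  fix I assume I: "cartan_trivial_ideal sh \<alpha> \<alpha>v I \<and>
    (\<forall>J. cartan_trivial_ideal sh \<alpha> \<alpha>v J \<and> I \<subseteq> J \<longrightarrow> J = I)"
  then have "I \<subseteq> \<Union>{I. cartan_trivial_ideal sh \<alpha> \<alpha>v I}" by blast
  then show "I = \<Union>{I. cartan_trivial_ideal sh \<alpha> \<alpha>v I}"
    using I greatest_cartan_trivial_ideal[OF assms] by metis
qed

end

theory Submission
  imports Defs "HOL-Computational_Algebra.Polynomial"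
begin

text \<open>
  A module that is free of rank one over \<open>U(\<h>)\<close> is the space of polynomial functions on
  \<open>\<h>\<^sup>*\<close>; there \<open>e\<^sub>i\<close> and \<open>f\<^sub>i\<close> act as \<open>a\<^sub>i \<sigma>\<^sub>i\<close> and \<open>b\<^sub>i \<sigma>\<^sub>i\<inverse>\<close>, where \<open>\<sigma>\<^sub>i\<close> is the shift by
  \<open>\<alpha>\<^sub>i\<close>. Put \<open>q\<^sub>i = a\<^sub>i \<sigma>\<^sub>i(b\<^sub>i)\<close>. The relations \<open>[e\<^sub>i, f\<^sub>i] = \<alpha>\<^sub>i\<^sup>\<or>\<close> give \<open>q\<^sub>i - \<sigma>\<^sub>i\<inverse>(q\<^sub>i) = \<alpha>\<^sub>i\<^sup>\<or>\<close>, and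
  \<open>[e\<^sub>i, f\<^sub>j] = [e\<^sub>j, f\<^sub>i] = 0\<close> give \<open>q\<^sub>i q\<^sub>j = \<sigma>\<^sub>j(q\<^sub>i) \<sigma>\<^sub>i(q\<^sub>j)\<close>. So \<open>q\<^sub>i\<close> is a quadratic polynomial in
  the coordinate dual to \<open>\<alpha>\<^sub>i\<close>, and has degree \<open>- a\<^sub>j\<^sub>i\<close> in the one dual to \<open>\<alpha>\<^sub>j\<close>. Comparing the exchange
  relations of three vertices, \<open>q\<^sub>i \<sigma>\<^sub>j\<sigma>\<^sub>k(q\<^sub>i) = \<sigma>\<^sub>j(q\<^sub>i) \<sigma>\<^sub>k(q\<^sub>i)\<close>; hence every vertex of the Dynkin
  diagram has at most two neighbours, and with exactly two neighbours \<open>j\<close>, \<open>k\<close> the polynomial \<open>q\<^sub>i\<close>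
  splits into two linear factors, one for each edge, and \<open>a\<^sub>j\<^sub>i = a\<^sub>k\<^sub>i = -1\<close>. At an end vertex \<open>i\<close>
  with neighbour \<open>j\<close> one finds \<open>a\<^sub>j\<^sub>i \<in> {-1, -2}\<close>; only diagrams with a single edge need a separate
  calculation.

  So all column sums of \<open>A\<close> are nonnegative, and \<open>A u = 0\<close> with \<open>u > 0\<close> forces them to vanish. On the
  affine subspace of \<open>\<h>\<^sup>*\<close> through a point where all \<open>\<alpha>\<^sub>i\<^sup>\<or>\<close> are 1 (the level is then nonzero),
  the constants of the linear factors add up to 0 at every vertex, but to \<open>-1\<close> or \<open>-3/2\<close> along
  every edge: a contradiction.
\<close>

section \<open>Polynomial functions on lines\<close>

text \<open>Shifting turns \<open>pCons a p\<close> into a + (t - 1) p(t - 1), so the induction step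
  for the second claim uses both claims for \<open>p\<close>; hence the joint proof.\<close>

lemma coeff_shift_top:
  fixes p :: "'a::comm_ring_1 poly"
  shows "degree p \<le> n \<Longrightarrow> coeff (pcompose p [:-1, 1:]) n = coeff p n"
    and "degree p \<le> Suc n \<Longrightarrow>
      coeff (pcompose p [:-1, 1:]) n = coeff p n - of_nat (Suc n) * coeff p (Suc n)"
proof (induction p arbitrary: n)
  case 0
  { case 1 show ?case by simp }
  { case 2 show ?case by simp }
next
  case (pCons a p)
  { case 1
    show ?case
    proof (cases n)
      case 0
      then have "p = 0" using 1 by (auto split: if_splits)
      then show ?thesis by (simp add: pcompose_pCons)
    next
      case (Suc m)
      have "degree p \<le> m" using 1 Suc by (cases "p = 0") auto
      then have "coeff (pcompose p [:-1,1:]) m = coeff p m"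
        "coeff (pcompose p [:-1,1:]) (Suc m) = coeff p (Suc m)"
        using pCons.IH(1)[of m] pCons.IH(1)[of "Suc m"] by auto
      moreover have "coeff p (Suc m) = 0" using \<open>degree p \<le> m\<close> by (simp add: coeff_eq_0)
      ultimately show ?thesis using Suc by (simp add: pcompose_pCons)
    qed }
  { case 2
    have dp: "degree p \<le> n" using 2 by (cases "p = 0") auto
    show ?case
    proof (cases n)
      case 0
      have "coeff (pcompose p [:-1,1:]) 0 = coeff p 0" using pCons.IH(1)[of 0] dp 0 by simp
      then show ?thesis using 0 by (simp add: pcompose_pCons)
    next
      case (Suc m)
      have "coeff (pcompose p [:-1,1:]) (Suc m) = coeff p (Suc m)"
        "coeff (pcompose p [:-1,1:]) m = coeff p m - of_nat (Suc m) * coeff p (Suc m)"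
        using pCons.IH(1)[of "Suc m"] pCons.IH(2)[of m] dp Suc by simp_all
      then show ?thesis using Suc by (simp add: pcompose_pCons algebra_simps)
    qed }
qed

text \<open>Compare the coefficients of t^(n + 1), where n is the degree: the contributions of b and
  of the coefficient of t^(n - 1) cancel, which leaves n times the leading coefficient against - a
  times it.\<close>

lemma degree_of_shift_ratio:
  fixes p :: "'a::{idom,ring_char_0} poly"
  assumes "p \<noteq> 0"
    and "\<And>t. (t^2 + b * t + e) * poly p t = (t^2 + (b - a) * t + e') * poly p (t - 1)"
  shows "of_nat (degree p) = - a"
proof -
  let ?s = "pcompose p [:-1, 1:]"
  define n where "n = degree p"
  have "poly ([:e, b, 1:] * p) = poly ([:e', b - a, 1:] * ?s)"
    using assms(2) by (intro ext) (simp add: poly_pcompose algebra_simps power2_eq_square)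
  then have eq: "[:e, b, 1:] * p = [:e', b - a, 1:] * ?s"
    by (simp only: poly_eq_poly_eq_iff)
  have top: "coeff ?s n = coeff p n" "coeff ?s (Suc n) = 0" "coeff p (Suc n) = 0"
    using coeff_shift_top(1)[of p n] coeff_shift_top(1)[of p "Suc n"] by (auto simp: n_def coeff_eq_0)
  have "coeff ([:e, b, 1:] * p) (Suc n) = coeff ([:e', b - a, 1:] * ?s) (Suc n)"
    using eq by simp
  then have "of_nat n * coeff p n = - a * coeff p n"
  proof (cases n)
    case 0
    then show "coeff ([:e, b, 1:] * p) (Suc n) = coeff ([:e', b - a, 1:] * ?s) (Suc n) \<Longrightarrow> ?thesis"
      using top by (simp add: algebra_simps)
  next
    case (Suc m)
    have "coeff ?s m = coeff p m - of_nat n * coeff p n"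
      using coeff_shift_top(2)[of p m] Suc by (simp add: n_def)
    then show "coeff ([:e, b, 1:] * p) (Suc n) = coeff ([:e', b - a, 1:] * ?s) (Suc n) \<Longrightarrow> ?thesis"
      using top Suc by (simp add: left_diff_distrib)
  qed
  moreover have "coeff p n \<noteq> 0" using assms(1) by (simp add: n_def)
  ultimately show ?thesis by (simp only: mult_cancel_right n_def) simp
qed

text \<open>After subtracting the expected linear function, the remainder is invariant under the
  shift and so vanishes at all natural numbers.\<close>

lemma poly_shift_diff_const:
  fixes p :: "'a::{idom,ring_char_0} poly"
  assumes "\<And>t. poly p t - poly p (t - 1) = c"
  shows "poly p t = poly p 0 + c * t"
proof -
  define r where "r = p - [:poly p 0, c:]"
  have step: "poly r t = poly r (t - 1)" for t
    using assms[of t] by (simp add: r_def algebra_simps)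
  have "poly r (of_nat n) = 0" for n
  proof (induction n)
    case (Suc n)
    then show ?case using step[of "of_nat (Suc n)"] by simp
  qed (simp add: r_def)
  then have "range of_nat \<subseteq> {x. poly r x = 0}" by auto
  moreover have "infinite (range (of_nat :: nat \<Rightarrow> 'a))"
    by (rule range_inj_infinite) (simp add: inj_def)
  ultimately have "r = 0" using poly_roots_finite finite_subset by blast
  then have "p = [:poly p 0, c:]" by (simp add: r_def)
  then show ?thesis by (metis poly_pCons poly_0 mult_zero_right add_0_right mult.commute)
qed

text \<open>A substitute for multivariate polynomials: cancelling factors only needs polynomiality on lines.\<close>

definition line_poly :: "(('i \<Rightarrow> 'a) \<Rightarrow> 'a::comm_ring_1) \<Rightarrow> bool" where
  "line_poly f \<longleftrightarrow> (\<forall>y z. \<exists>p. \<forall>t. f (\<lambda>k. y k + t * z k) = poly p t)"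

lemma line_polyD: "line_poly f \<Longrightarrow> \<exists>p. \<forall>t. f (\<lambda>k. y k + t * z k) = poly p t"
  unfolding line_poly_def by blast

lemma line_poly_add: "line_poly f \<Longrightarrow> line_poly g \<Longrightarrow> line_poly (\<lambda>y. f y + g y)"
  unfolding line_poly_def by (metis poly_add)

lemma line_poly_diff: "line_poly f \<Longrightarrow> line_poly g \<Longrightarrow> line_poly (\<lambda>y. f y - g y)"
  unfolding line_poly_def by (metis poly_diff)

lemma line_poly_mult: "line_poly f \<Longrightarrow> line_poly g \<Longrightarrow> line_poly (\<lambda>y. f y * g y)"
  unfolding line_poly_def by (metis poly_mult)

lemma line_poly_coordinate:
  assumes "line_poly f"
  obtains p where "\<And>t. f (y(m := t)) = poly p t"
proof -
  obtain p where "\<forall>t. f (\<lambda>k. (y(m := 0)) k + t * (if k = m then 1 else 0)) = poly p t"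
    using line_polyD[OF assms, of "y(m := 0)" "\<lambda>k. if k = m then 1 else 0"] ..
  moreover have "(\<lambda>k. (y(m := 0)) k + t * (if k = m then 1 else 0)) = y(m := t)" for t
    by auto
  ultimately show ?thesis using that by simp
qed

abbreviation down :: "'i \<Rightarrow> ('i \<Rightarrow> 'a::comm_ring_1) \<Rightarrow> 'i \<Rightarrow> 'a" where
  "down j y \<equiv> y(j := y j - 1)"

lemma down_commute: "j \<noteq> k \<Longrightarrow> down j (down k y) = down k (down j y)"
  by auto

lemma line_poly_down:
  assumes "line_poly f"
  shows "line_poly (\<lambda>y. f (down j y))"
  unfolding line_poly_def
proof (intro allI)
  fix y z
  obtain p where "\<forall>t. f (\<lambda>k. (down j y) k + t * z k) = poly p t"
    using line_polyD[OF assms, of "down j y" z] ..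
  moreover have "(\<lambda>k. (down j y) k + t * z k) = down j (\<lambda>k. y k + t * z k)" for t
    by auto
  ultimately show "\<exists>p. \<forall>t. f (down j (\<lambda>k. y k + t * z k)) = poly p t" by auto
qed

text \<open>On a line through a nonzero of \<open>f\<close> at parameter 0 and a nonzero of
  \<open>g\<close> at parameter 1, both restrictions would be nonzero polynomials with product
  zero.\<close>

lemma line_poly_no_zero_divisors:
  fixes f g :: "('i \<Rightarrow> 'a) \<Rightarrow> 'a::{idom,ring_char_0}"
  assumes "line_poly f" "line_poly g" "\<And>y. f y * g y = 0"
  shows "(\<forall>y. f y = 0) \<or> (\<forall>y. g y = 0)"
proof (rule ccontr)
  assume "\<not> ?thesis"
  then obtain y z where nz: "f y \<noteq> 0" "g z \<noteq> 0" by blast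
  obtain p where p: "\<forall>t. f (\<lambda>k. y k + t * (z k - y k)) = poly p t"
    using line_polyD[OF assms(1), of y "\<lambda>k. z k - y k"] ..
  obtain r where r: "\<forall>t. g (\<lambda>k. y k + t * (z k - y k)) = poly r t"
    using line_polyD[OF assms(2), of y "\<lambda>k. z k - y k"] ..
  have "poly (p * r) = poly 0"
  proof (rule ext)
    show "poly (p * r) t = poly 0 t" for t
      using assms(3)[of "\<lambda>k. y k + t * (z k - y k)"] p[rule_format, of t] r[rule_format, of t] by simp
  qed
  then have "p = 0 \<or> r = 0" by (simp only: poly_eq_poly_eq_iff mult_eq_0_iff)
  moreover have "poly p 0 \<noteq> 0" "poly r 1 \<noteq> 0" using nz p[THEN spec, of 0] r[THEN spec, of 1] by auto
  ultimately show False by auto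
qed

lemma constant_if_coordinatewise:
  fixes f :: "('i::finite \<Rightarrow> 'a) \<Rightarrow> 'b"
  assumes "\<And>y m t. f (y(m := t)) = f y"
  shows "f y = f z"
proof -
  have "f (\<lambda>k. if k \<in> S then z k else y k) = f y" if "finite S" for S
    using that
  proof (induction S)
    case (insert m S)
    have "(\<lambda>k. if k \<in> insert m S then z k else y k) = (\<lambda>k. if k \<in> S then z k else y k)(m := z m)"
      by auto
    then show ?case using assms insert by metis
  qed simp
  from this[of UNIV] show ?thesis by simp
qed

section \<open>The system of shift equations\<close>

text \<open>The coordinates \<open>y\<close> stand for the base point plus the sum of
  \<open>y k\<close> times the simple roots. Every coroot is 1 at the base point, which is the
  source of the constant 1 in \<open>diff\<close>. The relation \<open>exch\<close> encodes
  [e_i, f_j] = [e_j, f_i] = 0.\<close>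

locale shift_system =
  fixes a :: "'i::finite \<Rightarrow> 'i \<Rightarrow> int" and q :: "'i \<Rightarrow> ('i \<Rightarrow> complex) \<Rightarrow> complex"
  assumes diag [simp]: "a i i = 2"
    and nonpos: "i \<noteq> j \<Longrightarrow> a i j \<le> 0"
    and zero_sym: "a i j = 0 \<longleftrightarrow> a j i = 0"
    and lp: "line_poly (q i)"
    and diff: "q i y - q i (y(i := y i + 1)) = 1 + (\<Sum>j\<in>UNIV. of_int (a i j) * y j)"
    and exch: "i \<noteq> j \<Longrightarrow> q i y * q j y = q i (down j y) * q j (down i y)"
begin

text \<open>\<open>q_lin\<close> and \<open>q_const\<close> are the lower coefficients of
  \<open>- q i\<close> as a monic quadratic polynomial in \<open>y i\<close>; see
  \<open>q_quadratic\<close>.\<close>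

definition q_lin where "q_lin i y = (\<Sum>j\<in>- {i}. of_int (a i j) * y j)"
definition q_const where "q_const i y = - q i (y(i := 0))"

lemma q_lin_upd_self [simp]: "q_lin i (y(i := t)) = q_lin i y"
  unfolding q_lin_def by (intro sum.cong) auto

lemma q_const_upd_self [simp]: "q_const i (y(i := t)) = q_const i y"
  unfolding q_const_def by simp

lemma q_lin_upd: "j \<noteq> i \<Longrightarrow> q_lin i (y(j := t)) = q_lin i y + of_int (a i j) * (t - y j)"
  unfolding q_lin_def by (subst (1 2) sum.remove[of _ j]) (auto simp: algebra_simps intro!: sum.cong)

text \<open>In direction \<open>i\<close> the relation \<open>diff\<close> prescribes all
  differences of \<open>q i\<close>. The polynomial t^2 + \<open>q_lin i y\<close> t has the
  opposite differences, so the sum of the two is constant.\<close>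

lemma q_quadratic: "q i y = - ((y i)\<^sup>2 + q_lin i y * y i + q_const i y)"
proof -
  obtain p where p: "\<And>t. q i (y(i := t)) = poly p t"
    using line_poly_coordinate[OF lp] by blast
  define r where "r = p + [:0, q_lin i y, 1:]"
  have "poly r t - poly r (t - 1) = 0" for t
  proof -
    have "q i (y(i := t - 1)) - q i (y(i := t)) = 1 + (\<Sum>j\<in>UNIV. of_int (a i j) * (y(i := t - 1)) j)"
      using diff[of i "y(i := t - 1)"] by simp
    also have "(\<Sum>j\<in>UNIV. of_int (a i j) * (y(i := t - 1)) j) = 2 * (t - 1) + q_lin i (y(i := t - 1))"
      unfolding q_lin_def by (subst sum.remove[of _ i]) (auto simp: Compl_eq_Diff_UNIV)
    finally show ?thesis unfolding p by (simp add: r_def algebra_simps)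
  qed
  then have "poly r (y i) = poly r 0"
    using poly_shift_diff_const[of r 0 "y i"] by simp
  then show ?thesis
    using p[of "y i"] p[of 0] by (simp add: r_def q_const_def power2_eq_square algebra_simps eq_neg_iff_add_eq_0)
qed

lemma q_upd_self: "q i (y(i := t)) = - (t\<^sup>2 + q_lin i y * t + q_const i y)"
  using q_quadratic[of i "y(i := t)"] by simp

text \<open>In direction \<open>i\<close>, \<open>exch\<close> has the shape required by
  \<open>degree_of_shift_ratio\<close>: the linear coefficient of \<open>q i\<close> drops by
  \<open>a i j\<close> under \<open>down j\<close>, while \<open>q j\<close> is shifted by
  one.\<close>

lemma degree_q:
  assumes "i \<noteq> j" "\<And>t. q j (y(i := t)) = poly p t" "p \<noteq> 0"
  shows "int (degree p) = - a i j"
proof -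
  have "(t\<^sup>2 + q_lin i y * t + q_const i y) * poly p t
      = (t\<^sup>2 + (q_lin i y - of_int (a i j)) * t + q_const i (down j y)) * poly p (t - 1)" for t
  proof -
    have "down j (y(i := t)) = (down j y)(i := t)" "down i (y(i := t)) = y(i := t - 1)"
      using assms(1) by auto
    then have "q i (y(i := t)) * q j (y(i := t)) = q i ((down j y)(i := t)) * q j (y(i := t - 1))"
      using exch[OF assms(1), of "y(i := t)"] by simp
    then show ?thesis
      using assms(1) by (simp add: q_upd_self assms(2) q_lin_upd mult_minus_left minus_equation_iff) (simp add: algebra_simps)
  qed
  then have "of_nat (degree p) = - (of_int (a i j) :: complex)"
    by (rule degree_of_shift_ratio[OF assms(3)])
  then have "(of_int (int (degree p)) :: complex) = of_int (- a i j)" by simp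
  then show ?thesis by (simp only: of_int_eq_iff)
qed

lemma q_independent:
  assumes "m \<noteq> i" "a i m = 0"
  shows "q i (y(m := t)) = q i y"
proof -
  obtain p where p: "\<And>t. q i (y(m := t)) = poly p t"
    using line_poly_coordinate[OF lp] by blast
  have "degree p = 0"
    using degree_q[OF assms(1) p] assms(2) zero_sym[of i m] by (cases "p = 0") auto
  then obtain c where "p = [:c:]" by (metis degree_eq_zeroE)
  then show ?thesis using p[of t] p[of "y m"] by simp
qed

lemma q_const_independent: "m \<noteq> i \<Longrightarrow> a i m = 0 \<Longrightarrow> q_const i (y(m := t)) = q_const i y"
  unfolding q_const_def by (subst fun_upd_twist) (auto simp: q_independent)

lemma q_nonzero: "\<exists>y. q i y \<noteq> 0"
proof (rule ccontr)
  assume "\<not> ?thesis"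
  then have z: "q i y = 0" for y by blast
  have "t\<^sup>2 + q_lin i (\<lambda>_. 0) * t + q_const i (\<lambda>_. 0) = 0" for t
    using z[of "(\<lambda>_. 0)(i := t)"] unfolding q_upd_self by (simp only: neg_equal_0_iff_equal)
  from this[of 0] this[of 1] this[of "-1"] show False by (simp add: add_eq_0_iff)
qed

text \<open>Let X_i and Y_i be the two sides. Multiplying \<open>exch\<close> at \<open>y\<close>
  and at \<open>down k y\<close> crosswise gives X_i X_j = Y_i Y_j, and likewise for the other
  pairs. Hence (X_i - Y_i) (X_i + Y_i) X_j X_k = 0, where only the first factor can vanish
  identically.\<close>

lemma separation:
  assumes ne: "i \<noteq> j" "i \<noteq> k" "j \<noteq> k"
  shows "q i y * q i (down j (down k y)) = q i (down j y) * q i (down k y)"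
proof -
  define X where "X i j k y = q i y * q i (down j (down k y))" for i j k y
  define Y where "Y i j k y = q i (down j y) * q i (down k y)" for i j k y
  have XY: "X i j k y * X j i k y = Y i j k y * Y j i k y" if "i \<noteq> j" "i \<noteq> k" "j \<noteq> k" for i j k y
  proof -
    have "q i y * q j y = q i (down j y) * q j (down i y)"
      "q i (down k y) * q j (down k y) = q i (down j (down k y)) * q j (down i (down k y))"
      using that exch[of i j y] exch[of i j "down k y"] by simp_all
    then show ?thesis unfolding X_def Y_def by algebra
  qed
  have sym: "X i k j y = X i j k y" "Y i k j y = Y i j k y" if "j \<noteq> k" for i j k y
    unfolding X_def Y_def using that by (auto simp: fun_upd_twist[of k j] mult.commute)
  have l: "line_poly (X i j k)" "line_poly (Y i j k)" for i j k
    unfolding X_def Y_def by (intro line_poly_mult line_poly_down lp line_poly_down[of "\<lambda>y. q i (down j y)" for i j])+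
  have "X i j k y * X j i k y = Y i j k y * Y j i k y"
    "X i j k y * X k i j y = Y i j k y * Y k i j y"
    "X j i k y * X k i j y = Y j i k y * Y k i j y" for y
    using XY[of i j k y] XY[of i k j y] XY[of j k i y] sym ne by metis+
  moreover have "(x1 - y1) * ((x1 + y1) * (x2 * x3)) = 0"
    if "x1 * x2 = y1 * y2" "x1 * x3 = y1 * y3" "x2 * x3 = y2 * y3" for x1 x2 x3 y1 y2 y3 :: complex
    using that by algebra
  ultimately have "(X i j k y - Y i j k y) * ((X i j k y + Y i j k y) * (X j i k y * X k i j y)) = 0" for y
    by blast
  then have "(\<forall>y. X i j k y - Y i j k y = 0) \<or>
      (\<forall>y. (X i j k y + Y i j k y) * (X j i k y * X k i j y) = 0)"
    by (rule line_poly_no_zero_divisors[OF line_poly_diff[OF l]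
          line_poly_mult[OF line_poly_add[OF l] line_poly_mult[OF l(1) l(1)]]])
  moreover have "(\<forall>y. X i j k y + Y i j k y = 0) \<or> (\<forall>y. X j i k y * X k i j y = 0)"
    if "\<forall>y. (X i j k y + Y i j k y) * (X j i k y * X k i j y) = 0"
    by (rule line_poly_no_zero_divisors[OF line_poly_add[OF l] line_poly_mult[OF l(1) l(1)]
          that[rule_format]])
  moreover have "(\<forall>y. X j i k y = 0) \<or> (\<forall>y. X k i j y = 0)"
    if "\<forall>y. X j i k y * X k i j y = 0"
    by (rule line_poly_no_zero_divisors[OF l(1) l(1) that[rule_format]])
  moreover have "\<not> (\<forall>y. X i j k y = 0)" for i j k
  proof
    assume "\<forall>y. X i j k y = 0"
    then have "(\<forall>y. q i y = 0) \<or> (\<forall>y. q i (down j (down k y)) = 0)"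
      unfolding X_def
      by (intro line_poly_no_zero_divisors lp line_poly_down[of "\<lambda>y. q i (down j y)"] line_poly_down) auto
    moreover obtain z where "q i z \<noteq> 0" using q_nonzero by blast
    moreover have "\<exists>y. down j (down k y) = z"
    proof -
      let ?u = "z(j := z j + 1)"
      have "down j (down k (?u(k := ?u k + 1))) = z" by auto
      then show ?thesis by blast
    qed
    ultimately show False by metis
  qed
  \<comment> \<open>Both products are monic of degree 4 in \<open>y i\<close>, so their sum has
    leading coefficient 2.\<close>
  moreover have "\<not> (\<forall>y. X i j k y + Y i j k y = 0)"
  proof
    assume 0: "\<forall>y. X i j k y + Y i j k y = 0"
    let ?P = "\<lambda>y. [:q_const i y, q_lin i y, 1:]"
    let ?o = "\<lambda>_. 0 :: complex"
    let ?p = "?P ?o * ?P (down j (down k ?o)) + ?P (down j ?o) * ?P (down k ?o)"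
    have "poly ?p t = X i j k (?o(i := t)) + Y i j k (?o(i := t))" for t
    proof -
      have d: "down j (?o(i := t)) = (down j ?o)(i := t)" "down k (?o(i := t)) = (down k ?o)(i := t)"
        "down j ((down k ?o)(i := t)) = (down j (down k ?o))(i := t)"
        using ne by auto
      show ?thesis unfolding X_def Y_def d q_upd_self
        by (simp add: power2_eq_square algebra_simps)
    qed
    then have "poly ?p = poly 0" using 0 by (intro ext) simp
    then have "?p = 0" by (simp only: poly_eq_poly_eq_iff)
    then have "coeff ?p 4 = 0" by simp
    then show False by (simp add: numeral_eq_Suc coeff_mult)
  qed
  ultimately have "X i j k y - Y i j k y = 0" by blast
  then show ?thesis unfolding X_def Y_def by simp
qed

end

lemma exists_nonvanishing:
  fixes u v c d :: complex
  assumes "u \<noteq> 0" "v \<noteq> 0"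
  obtains t where "u * t + c \<noteq> 0" "v * t + d \<noteq> 0"
proof -
  obtain t where "t \<notin> {- c / u, - d / v}"
    by (metis ex_new_if_finite infinite_UNIV_char_0 finite.emptyI finite.insertI)
  then show ?thesis using assms by (intro that[of t]) (auto simp: field_simps add_eq_0_iff)
qed

section \<open>Neighbours in the diagram and linear factors of \<open>q i\<close>\<close>

context shift_system begin

lemma q_lin_down: "j \<noteq> i \<Longrightarrow> q_lin i (down j y) = q_lin i y - of_int (a i j)"
  by (simp add: q_lin_upd)

text \<open>These come from the coefficients of t^2, t and 1 in \<open>separation\<close> along
  direction \<open>i\<close>; the higher ones agree anyway. The first equation eliminates the doubly
  shifted constant from the other two.\<close>

lemma separation_coeffs:
  assumes ne: "i \<noteq> j" "i \<noteq> k" "j \<noteq> k"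
  defines "\<beta> \<equiv> of_int (a i j)" and "\<gamma> \<equiv> of_int (a i k)"
  defines "\<Delta> \<equiv> \<lambda>j y. q_const i y - q_const i (down j y)"
  shows "q_const i (down j (down k y)) = q_const i y - \<Delta> j y - \<Delta> k y + \<beta> * \<gamma>"
    and "q_lin i y * (\<beta> * \<gamma>) = \<beta> * \<Delta> k y + \<gamma> * \<Delta> j y"
    and "q_const i y * (\<beta> * \<gamma>) = \<Delta> j y * \<Delta> k y"
proof -
  have *: "(t\<^sup>2 + q_lin i y * t + q_const i y) * (t\<^sup>2 + (q_lin i y - \<beta> - \<gamma>) * t + q_const i (down j (down k y))) =
    (t\<^sup>2 + (q_lin i y - \<beta>) * t + q_const i (down j y)) * (t\<^sup>2 + (q_lin i y - \<gamma>) * t + q_const i (down k y))" for t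
  proof -
    let ?y = "y(i := t)"
    have d: "down j ?y = (down j y)(i := t)" "down k ?y = (down k y)(i := t)"
        "down j ((down k y)(i := t)) = (down j (down k y))(i := t)"
      using ne by auto
    have b: "q_lin i (down j y) = q_lin i y - \<beta>" "q_lin i (down k y) = q_lin i y - \<gamma>"
       "q_lin i (down j (down k y)) = q_lin i y - \<beta> - \<gamma>"
      using q_lin_down[of j i y] q_lin_down[of k i y] q_lin_down[of j i "down k y"] ne
      unfolding \<beta>_def \<gamma>_def by auto
    show ?thesis
      using separation[OF ne, of ?y] unfolding d q_upd_self b by (simp only: minus_mult_minus)
  qed
  define X where "X = q_const i (down j (down k y))"
  define P where "P = q_const i (down j y)"
  define Q where "Q = q_const i (down k y)"
  define f where "f t = (t\<^sup>2 + q_lin i y * t + q_const i y) * (t\<^sup>2 + (q_lin i y - \<beta> - \<gamma>) * t + X) -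
    (t\<^sup>2 + (q_lin i y - \<beta>) * t + P) * (t\<^sup>2 + (q_lin i y - \<gamma>) * t + Q)" for t
  have f: "f t = (q_const i y + X - P - Q - \<beta> * \<gamma>) * t\<^sup>2 +
      (q_lin i y * X + q_const i y * (q_lin i y - \<beta> - \<gamma>) - (q_lin i y - \<beta>) * Q - (q_lin i y - \<gamma>) * P) * t +
      (q_const i y * X - P * Q)" for t
    unfolding f_def by (simp add: power2_eq_square algebra_simps)
  have "f t = 0" for t using *[of t] unfolding f_def X_def P_def Q_def by simp
  have quad: "u = 0 \<and> v = 0 \<and> w = 0" if "\<And>t. u * t\<^sup>2 + v * t + w = 0" for u v w :: complex
  proof -
    have "w = 0" "u + v + w = 0" "u - v + w = 0"
      using that[of 0] that[of 1] that[of "-1"] by simp_all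
    then have "w = 0" "2 * u = 0" "v = - u" by (simp_all add: eq_neg_iff_add_eq_0 add.commute)
    then show ?thesis by simp
  qed
  note c = quad[OF \<open>\<And>t. f t = 0\<close>[unfolded f]]
  have X: "X = P + Q + \<beta> * \<gamma> - q_const i y"
    using c by (simp add: algebra_simps)
  show "q_const i (down j (down k y)) = q_const i y - \<Delta> j y - \<Delta> k y + \<beta> * \<gamma>"
    using X unfolding X_def P_def Q_def \<Delta>_def by simp
  show "q_lin i y * (\<beta> * \<gamma>) = \<beta> * \<Delta> k y + \<gamma> * \<Delta> j y"
    using c unfolding \<Delta>_def P_def[symmetric] Q_def[symmetric] X by (simp add: algebra_simps)
  show "q_const i y * (\<beta> * \<gamma>) = \<Delta> j y * \<Delta> k y"
    using c unfolding \<Delta>_def P_def[symmetric] Q_def[symmetric] X by (simp add: algebra_simps)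
qed

definition nbrs where "nbrs i = {j. j \<noteq> i \<and> a i j \<noteq> 0}"

lemma nbrs_sym: "j \<in> nbrs i \<longleftrightarrow> i \<in> nbrs j"
  unfolding nbrs_def using zero_sym by blast

text \<open>For two neighbours \<open>j\<close>, \<open>k\<close> of \<open>i\<close>, the numbers \<open>- lroot i j y\<close> and \<open>- lroot i k y\<close> are the
  zeros of \<open>q i\<close> as a quadratic polynomial in the \<open>i\<close>-th coordinate.\<close>

definition lroot where "lroot i j y = (q_const i y - q_const i (down j y)) / of_int (a i j)"

text \<open>Dividing \<open>separation_coeffs\<close> by the nonzero entries \<open>a i j\<close>
  and \<open>a i k\<close> gives Vieta's formulas; the third claim is the mixed second difference of
  \<open>q_const\<close>.\<close>

lemma lroot_sum_prod:
  assumes "j \<in> nbrs i" "k \<in> nbrs i" "j \<noteq> k"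
  shows "lroot i j y + lroot i k y = q_lin i y" and "lroot i j y * lroot i k y = q_const i y"
    and "lroot i j (down k y) = lroot i j y - of_int (a i k)"
proof -
  have ne: "i \<noteq> j" "i \<noteq> k" "j \<noteq> k" and nz: "of_int (a i j) \<noteq> (0::complex)" "of_int (a i k) \<noteq> (0::complex)"
    using assms by (auto simp: nbrs_def)
  have dc: "down j (down k y) = down k (down j y)" using ne by auto
  note c = separation_coeffs[OF ne, of y]
  show "lroot i j y + lroot i k y = q_lin i y" "lroot i j y * lroot i k y = q_const i y"
    using c(2,3) nz unfolding lroot_def by (simp_all add: field_simps)
  show "lroot i j (down k y) = lroot i j y - of_int (a i k)"
    using c(1) nz unfolding lroot_def by (simp add: field_simps)
qed

text \<open>With three neighbours all pairwise sums of \<open>lroot\<close> would equal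
  \<open>q_lin i y\<close>. So \<open>q i\<close> would have a double root and
  \<open>q_const i\<close> would be the square of \<open>q_lin i\<close> over 4. Its drop under
  \<open>down j\<close> differs from the one expressed by \<open>lroot\<close> by the square of
  \<open>a i j\<close> over 4, so \<open>a i j\<close> would be 0.\<close>

lemma card_nbrs: "card (nbrs i) \<le> 2"
proof (rule ccontr)
  assume "\<not> ?thesis"
  then have "3 \<le> card (nbrs i)" by simp
  then obtain S where "S \<subseteq> nbrs i" "card S = 3" by (metis obtain_subset_with_card_n)
  then obtain j k m where m: "j \<in> nbrs i" "k \<in> nbrs i" "m \<in> nbrs i" "j \<noteq> k" "j \<noteq> m" "k \<noteq> m"
    by (auto simp: card_3_iff)
  have r: "lroot i j y = q_lin i y / 2" "q_const i y = (q_lin i y)\<^sup>2 / 4" for y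
  proof -
    note s = lroot_sum_prod(1)[OF m(1,2,4), of y] lroot_sum_prod(1)[OF m(1,3,5), of y]
      lroot_sum_prod(1)[OF m(2,3,6), of y] lroot_sum_prod(2)[OF m(1,2,4), of y]
    have 1: "lroot i j y = lroot i k y" using s(2) s(3)[symmetric] by simp
    have 2: "q_lin i y = 2 * lroot i j y" using s(1)[symmetric] unfolding 1 by (simp only: mult_2)
    show "lroot i j y = q_lin i y / 2" using 2 by simp
    show "q_const i y = (q_lin i y)\<^sup>2 / 4"
      using s(4) unfolding 2 unfolding 1 by (simp add: power2_eq_square)
  qed
  have nz: "of_int (a i j) \<noteq> (0::complex)" and "j \<noteq> i" using m by (auto simp: nbrs_def)
  have "of_int (a i j) * lroot i j y = q_const i y - q_const i (down j y)" for y
    unfolding lroot_def using nz by simp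
  then have "(of_int (a i j))\<^sup>2 = (0::complex)"
    unfolding r(2) q_lin_down[OF \<open>j \<noteq> i\<close>] unfolding r(1) by (simp add: field_simps power2_eq_square)
  then show False using nz by simp
qed

text \<open>Under \<open>down j\<close> both \<open>q_lin i\<close>, the sum of the roots, and
  \<open>lroot i k\<close> drop by \<open>a i j\<close>.\<close>

lemma lroot_down_self:
  assumes "j \<in> nbrs i" "k \<in> nbrs i" "j \<noteq> k"
  shows "lroot i j (down j y) = lroot i j y"
proof -
  have "j \<noteq> i" using assms by (simp add: nbrs_def)
  have "lroot i j (down j y) = q_lin i (down j y) - lroot i k (down j y)"
    using lroot_sum_prod(1)[OF assms, of "down j y"] by (simp add: eq_diff_eq)
  also have "\<dots> = q_lin i y - of_int (a i j) - (lroot i k y - of_int (a i j))"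
    by (simp only: q_lin_down[OF \<open>j \<noteq> i\<close>] lroot_sum_prod(3)[OF assms(2,1) assms(3)[symmetric]])
  also have "\<dots> = lroot i j y"
    using lroot_sum_prod(1)[OF assms, of y] by (simp add: diff_eq_eq add.commute)
  finally show ?thesis .
qed

text \<open>Once the multiple of \<open>y k\<close> is subtracted, unit steps in the directions
  \<open>j\<close> and \<open>k\<close> change nothing, and by polynomiality neither do arbitrary
  changes of these coordinates. The remaining coordinates do not enter
  \<open>q_const i\<close>.\<close>

lemma lroot_linear:
  assumes N: "nbrs i = {j, k}" and "j \<noteq> k"
  shows "lroot i j y = of_int (a i k) * y k + lroot i j (\<lambda>_. 0)"
proof -
  have jk: "j \<in> nbrs i" "k \<in> nbrs i" using N by auto
  then have ji: "j \<noteq> i" "k \<noteq> i" by (auto simp: nbrs_def)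
  define f where "f y = lroot i j y - of_int (a i k) * y k" for y
  have "f (y(m := t)) = f y" for y m t
  proof (cases "m = j \<or> m = k")
    case True
    have "line_poly (q_const i)"
      unfolding q_const_def line_poly_def
    proof (intro allI)
      fix y z :: "'i \<Rightarrow> complex"
      obtain p where p: "\<forall>t. q i (\<lambda>k. (y(i := 0)) k + t * (z(i := 0)) k) = poly p t"
        using line_polyD[OF lp, of i "y(i := 0)" "z(i := 0)"] ..
      have "(\<lambda>k. (y(i := 0)) k + t * (z(i := 0)) k) = (\<lambda>k. y k + t * z k)(i := 0)" for t by auto
      then have "- q i ((\<lambda>k. y k + t * z k)(i := 0)) = poly (- p) t" for t using p by (metis poly_minus)
      then show "\<exists>p. \<forall>t. - q i ((\<lambda>k. y k + t * z k)(i := 0)) = poly p t" by blast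
    qed
    then have "line_poly (\<lambda>y. q_const i y - q_const i (down j y))"
      by (intro line_poly_diff line_poly_down)
    then obtain p where p: "\<And>t. q_const i (y(m := t)) - q_const i (down j (y(m := t))) = poly p t"
      by (rule line_poly_coordinate[where y = y and m = m]) blast
    define r where "r = smult (1 / of_int (a i j)) p - (if m = k then [:0, of_int (a i k):] else [:of_int (a i k) * y k:])"
    have r: "poly r t = f (y(m := t))" for t
      unfolding f_def lroot_def p r_def by (simp add: mult.commute)
    have "poly r t - poly r (t - 1) = 0" for t
    proof -
      have "y(m := t - 1) = down m (y(m := t))" by simp
      then have "poly r (t - 1) = f (down m (y(m := t)))" using r by metis
      also have "\<dots> = f (y(m := t))"
        using True lroot_sum_prod(3)[OF jk \<open>j \<noteq> k\<close>, of "y(m := t)"]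
          lroot_down_self[OF jk \<open>j \<noteq> k\<close>, of "y(m := t)"] \<open>j \<noteq> k\<close>
        unfolding f_def by (auto simp: algebra_simps)
      finally show ?thesis by (simp add: r)
    qed
    then have "poly r t = poly r (y m)" using poly_shift_diff_const[of r 0] by (metis mult_zero_left add_0_right)
    then show ?thesis by (simp add: r)
  next
    case False
    have "q_const i (y(m := t)) = q_const i y" for y
    proof (cases "m = i")
      case False
      moreover have "a i m = 0" using False \<open>\<not> (m = j \<or> m = k)\<close> N by (auto simp: nbrs_def)
      ultimately show ?thesis by (rule q_const_independent)
    qed simp
    moreover have "down j (y(m := t)) = (down j y)(m := t)" using False by auto
    ultimately show ?thesis unfolding f_def lroot_def using False by auto
  qed
  then have "f y = f (\<lambda>_. 0)" by (rule constant_if_coordinatewise)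
  then show ?thesis by (simp add: f_def diff_eq_eq add.commute)
qed

text \<open>The indices cross over: \<open>lroot i k\<close> depends on \<open>y j\<close> and
  yields the factor of the edge to \<open>j\<close>. The constants add up to \<open>q_lin i\<close>
  at the origin.\<close>

lemma factorization:
  assumes N: "nbrs i = {j, k}" and "j \<noteq> k"
  obtains c d where "c + d = 0"
    and "\<And>y. q i y = - ((y i + of_int (a i j) * y j + c) * (y i + of_int (a i k) * y k + d))"
proof -
  have jk: "j \<in> nbrs i" "k \<in> nbrs i" using N by auto
  have l: "lroot i j y = of_int (a i k) * y k + lroot i j (\<lambda>_. 0)"
    "lroot i k y = of_int (a i j) * y j + lroot i k (\<lambda>_. 0)" for y
    using lroot_linear[of i j k y] lroot_linear[of i k j y] assms by (auto simp: insert_commute)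
  show ?thesis
  proof (rule that)
    show "lroot i k (\<lambda>_. 0) + lroot i j (\<lambda>_. 0) = 0"
      using lroot_sum_prod(1)[OF jk \<open>j \<noteq> k\<close>, of "\<lambda>_. 0"] by (simp add: q_lin_def add.commute)
    have "q i y = - ((y i + lroot i k y) * (y i + lroot i j y))" for y
      using lroot_sum_prod(1,2)[OF jk \<open>j \<noteq> k\<close>, of y, symmetric]
      by (simp add: q_quadratic power2_eq_square algebra_simps)
    then show "q i y = - ((y i + of_int (a i j) * y j + lroot i k (\<lambda>_. 0)) *
       (y i + of_int (a i k) * y k + lroot i j (\<lambda>_. 0)))" for y
      using l[of y] by (simp add: add.assoc)
  qed
qed

lemma interior_column:
  assumes N: "nbrs i = {j, k}" and "j \<noteq> k"
  shows "a j i = - 1"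
proof -
  have jk: "j \<in> nbrs i" "k \<in> nbrs i" using N by auto
  then have ne: "j \<noteq> i" "k \<noteq> i" and nz: "a i j \<noteq> 0" by (auto simp: nbrs_def)
  obtain c d where f: "\<And>y. q i y = - ((y i + of_int (a i j) * y j + c) * (y i + of_int (a i k) * y k + d))"
    using factorization[OF assms] by metis
  \<comment> \<open>At this point the factor of the edge to \<open>k\<close> equals 1, so
    \<open>q i\<close> is linear in \<open>y j\<close> with slope \<open>- a i j\<close>, and
    \<open>degree_q\<close> applies.\<close>
  let ?y = "(\<lambda>_. 0)(i := 1 - d)"
  let ?p = "[: - (1 - d + c), - of_int (a i j) :] :: complex poly"
  have "q i (?y(j := t)) = poly ?p t" for t
    unfolding f using ne \<open>j \<noteq> k\<close> by (simp add: algebra_simps)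
  then have "int (degree ?p) = - a j i"
    using nz ne by (intro degree_q[of j i ?y]) auto
  then show ?thesis using nz by simp
qed

end

section \<open>Identities in two variables along a single edge\<close>

text \<open>Here y and z are the coordinates at an end vertex and at its neighbour. The values y = 0
  and y = 1 give a recursion for \<open>E\<close> and its differences, hence a closed form; the
  differences of this closed form are consistent only for the listed values.\<close>

lemma end_edge_identity:
  fixes E :: "complex \<Rightarrow> complex"
  assumes "p \<noteq> 0"
    and eq: "\<And>y z. (y\<^sup>2 - y * z + E z) * (z + c - p * y) =
      (y\<^sup>2 - y * (z - 1) + E (z - 1)) * (z + c + p - p * y)"
  shows "p = 1 \<or> (p = 2 \<and> c = - 3/2)"
proof -
  define D where "D z = (p - 1) * z - (c + p)" for z
  have 0: "E z * (z + c) = E (z - 1) * (z + c + p)" for z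
    using eq[of 0 z] by simp
  have 1: "p * (E z - E (z - 1)) = D z" for z
    using eq[of 1 z] 0[of z] by (simp add: D_def algebra_simps)
  have 2: "p * p * E z = D z * (z + c + p)" for z
  proof -
    have "p * (E z * (z + c)) = (p * E z - D z) * (z + c + p)"
      unfolding 0 1[symmetric] by (simp add: algebra_simps)
    then show ?thesis by (simp add: algebra_simps)
  qed
  have 3: "D z * (z + c + p) - D (z - 1) * (z - 1 + c + p) = p * D z" for z
  proof -
    have "D z * (z + c + p) - D (z - 1) * (z - 1 + c + p) = p * p * E z - p * p * E (z - 1)"
      by (simp only: 2)
    also have "\<dots> = p * D z"
      unfolding 1[symmetric] by (simp add: algebra_simps)
    finally show ?thesis .
  qed
  have "(p - 1) * (2 * (c + p) - 1) = 0" "(p - 1) * (2 * (c + p) + 1 - p) = 0"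
    using 3[of 0] 3[of 1] unfolding D_def by (simp_all add: algebra_simps)
  then have "p = 1 \<or> (2 * (c + p) = 1 \<and> 2 * (c + p) + 1 = p)" by auto
  moreover have "p = 2 \<and> c = - 3/2" if "2 * (c + p) = 1" "2 * (c + p) + 1 = p"
  proof -
    have "p = 2" using that by simp
    then show ?thesis using that(1) by (simp add: field_simps add_eq_0_iff)
  qed
  ultimately show ?thesis by blast
qed

text \<open>This is the edge of A_2^(2). The values y = 0 and y = 1 give two recursions for
  \<open>E\<close> with the common factor z - s, where s = m/4; with it removed, they contradict
  each other at z = s + 1 and z = s + 2.\<close>

lemma edge_1_4_identity:
  fixes E :: "complex \<Rightarrow> complex"
  assumes eq: "\<And>y z. (y\<^sup>2 - y * z + E z) * (z\<^sup>2 - 4 * y * z + (m * y + n)) =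
    (y\<^sup>2 - y * (z - 1) + E (z - 1)) * (z\<^sup>2 - 4 * (y - 1) * z + (m * (y - 1) + n))"
  shows False
proof -
  define s where "s = m / 4"
  have m: "m = 4 * s" by (simp add: s_def)
  have 0: "E z * (z\<^sup>2 + n) = E (z - 1) * (z\<^sup>2 + n + 4 * z - m)" for z
    using eq[of 0 z] by (simp add: algebra_simps)
  have 1: "(E z - E (z - 1)) * (m - 4 * z) = z * (z\<^sup>2 + n) - (z - 1) * (z\<^sup>2 + n + 4 * z - m)" for z
  proof -
    define X where "X = z\<^sup>2 + n"
    define W where "W = m - 4 * z"
    have "(1 - z + E z) * (X + W) = (2 - z + E (z - 1)) * X" "E z * X = E (z - 1) * (X - W)"
      using eq[of 1 z] 0[of z] by (simp_all add: X_def W_def algebra_simps)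
    moreover have "(E z - E (z - 1)) * W = ((1 - z + E z) * (X + W) - (2 - z + E (z - 1)) * X) -
        (E z * X - E (z - 1) * (X - W)) + (z * X - (z - 1) * (X - W))"
      by (simp add: algebra_simps)
    ultimately show ?thesis by (simp add: X_def W_def algebra_simps)
  qed
  \<comment> \<open>At z = s the factor m - 4 z vanishes, and the right-hand side becomes s^2 +
    n.\<close>
  have n: "n = - s\<^sup>2"
    using 1[of s] by (simp add: m algebra_simps power2_eq_square eq_neg_iff_add_eq_0)
  have d: "4 * (E (s + k) - E (s + k - 1)) = 2 * s + 3 * k - 4"
    "E (s + k) * (2 * s + k) = E (s + k - 1) * (2 * s + k + 4)" if "k \<noteq> 0" for k
  proof -
    have "k * (4 * (E (s + k) - E (s + k - 1))) = k * (2 * s + 3 * k - 4)"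
      using 1[of "s + k"] by (simp add: m n power2_eq_square algebra_simps)
    then show "4 * (E (s + k) - E (s + k - 1)) = 2 * s + 3 * k - 4" using that by simp
    have "k * (E (s + k) * (2 * s + k)) = k * (E (s + k - 1) * (2 * s + k + 4))"
      using 0[of "s + k"] by (simp add: m n power2_eq_square algebra_simps)
    then show "E (s + k) * (2 * s + k) = E (s + k - 1) * (2 * s + k + 4)" using that by simp
  qed
  define u where "u = E s"
  define v where "v = E (s + 1)"
  define w where "w = E (s + 2)"
  have "4 * (v - u) = 2 * s - 1" "4 * (w - v) = 2 * s + 2"
    "v * (2 * s + 1) = u * (2 * s + 5)" "w * (2 * s + 2) = v * (2 * s + 6)"
    using d[of 1] d[of 2] by (simp_all add: u_def v_def w_def add.commute diff_add_eq algebra_simps)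
  \<comment> \<open>Together the equations give 16 u = (2 s - 1) (2 s + 1) and 16 v = (2 s + 2)^2,
    so 16 (v - u) = 8 s + 5, whereas the first one gives 8 s - 4.\<close>
  then show False by algebra
qed

text \<open>This is the edge of A_1^(1). The difference of the two sides is a polynomial that
  vanishes identically; finite differences extract enough of its coefficients.\<close>

lemma edge_2_2_identity:
  fixes e f g e' f' g' :: complex
  assumes eq: "\<And>y z. (y\<^sup>2 - 2 * y * z + (e * z\<^sup>2 + f * z + g)) * (z\<^sup>2 - 2 * z * y + (e' * y\<^sup>2 + f' * y + g')) =
    (y\<^sup>2 - 2 * y * (z - 1) + (e * (z - 1)\<^sup>2 + f * (z - 1) + g)) *
    (z\<^sup>2 - 2 * z * (y - 1) + (e' * (y - 1)\<^sup>2 + f' * (y - 1) + g'))"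
  shows False
proof -
  define F where "F y z = (y\<^sup>2 - 2 * y * z + (e * z\<^sup>2 + f * z + g)) * (z\<^sup>2 - 2 * z * y + (e' * y\<^sup>2 + f' * y + g')) -
    (y\<^sup>2 - 2 * y * (z - 1) + (e * (z - 1)\<^sup>2 + f * (z - 1) + g)) *
    (z\<^sup>2 - 2 * z * (y - 1) + (e' * (y - 1)\<^sup>2 + f' * (y - 1) + g'))" for y z
  have F: "F y z = 0" for y z using eq[of y z] by (simp add: F_def)
  \<comment> \<open>The terms of degree 4 cancel in \<open>F\<close>, so these mixed differences are
    twice the coefficients of y^2 z and y z^2.\<close>
  have "F 2 1 - 2 * F 1 1 + F 0 1 - F 2 0 + 2 * F 1 0 - F 0 0 = 4 * (1 - 2 * e' + e * e')"
    "F 1 2 - 2 * F 1 1 + F 1 0 - F 0 2 + 2 * F 0 1 - F 0 0 = 4 * (1 - 2 * e + e * e')"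
    unfolding F_def by (simp_all add: power2_eq_square algebra_simps)
  then have "4 * (1 - 2 * e' + e * e') = 0" "4 * (1 - 2 * e + e * e') = 0"
    unfolding F by simp_all
  then have h: "1 - 2 * e' + e * e' = 0" "1 - 2 * e + e * e' = 0"
    by (simp_all only: mult_eq_0_iff numeral_neq_zero simp_thms)
  then have "2 * e = 2 * e'" by (simp add: algebra_simps)
  then have "(e - 1)\<^sup>2 = 0" using h by (simp add: power2_eq_square algebra_simps)
  then have e: "e = 1" "e' = 1" using \<open>2 * e = 2 * e'\<close> by simp_all
  \<comment> \<open>Now the quadratic parts are squares of y - z, so differences along the diagonal
    leave only \<open>f\<close> and \<open>f'\<close>.\<close>
  have "F 1 1 - F 0 0 = f * (f' - 1) - f' * (1 - f)"
    "F 2 1 - F 1 0 = f * (f' + 1) - f' * (3 - f)"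
    unfolding F_def e by (simp_all add: power2_eq_square algebra_simps)
  then have h: "f * (f' - 1) = f' * (1 - f)" "f * (f' + 1) = f' * (3 - f)"
    unfolding F by simp_all
  then have "2 * f = 2 * f'" by (simp add: algebra_simps)
  then have f': "f' = f" by simp
  then have "f * (f - 1) = 0" using h by (simp add: algebra_simps)
  then have "f = 0 \<or> f = 1" by (simp only: mult_eq_0_iff right_minus_eq)
  \<comment> \<open>On the line z = 0 the coefficient of y^2 in \<open>F\<close> is 2.\<close>
  then have "F 1 0 - 2 * F 0 0 + F (-1) 0 = 4"
    unfolding F_def e f' by (auto simp: power2_eq_square algebra_simps)
  then show False unfolding F by simp
qed

lemma poly_degree_le_2:
  fixes p :: "'a::comm_semiring_1 poly"
  assumes "degree p \<le> 2"
  shows "poly p x = coeff p 2 * x\<^sup>2 + coeff p 1 * x + coeff p 0"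
proof -
  have "p = [:coeff p 0, coeff p 1, coeff p 2:]"
    using assms by (intro poly_eqI) (auto simp: coeff_pCons numeral_2_eq_2 coeff_eq_0 split: nat.splits)
  then have "poly p x = poly [:coeff p 0, coeff p 1, coeff p 2:] x" by (rule arg_cong)
  then show ?thesis by (simp add: algebra_simps power2_eq_square)
qed

section \<open>Entries and constants of isolated, end and inner edges\<close>

context shift_system begin

lemma q_lin_single: "i \<noteq> j \<Longrightarrow> q_lin i ((\<lambda>_. 0)(j := z)) = of_int (a i j) * z"
  using q_lin_upd[of j i "\<lambda>_. 0" z] by (simp add: q_lin_def)

lemma q_plane:
  "i \<noteq> j \<Longrightarrow> q i ((\<lambda>_. 0)(i := t, j := z)) = - (t\<^sup>2 + of_int (a i j) * z * t + q_const i ((\<lambda>_. 0)(j := z)))"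
  by (subst fun_upd_twist) (auto simp: q_upd_self q_lin_single)

text \<open>The exchange relation on the plane where all coordinates except \<open>i\<close> and
  \<open>j\<close> are 0; it feeds the two-variable identities.\<close>

lemma plane_identity:
  assumes "i \<noteq> j"
  shows "(y\<^sup>2 + of_int (a i j) * z * y + q_const i ((\<lambda>_. 0)(j := z))) *
      (z\<^sup>2 + of_int (a j i) * y * z + q_const j ((\<lambda>_. 0)(i := y))) =
    (y\<^sup>2 + of_int (a i j) * (z - 1) * y + q_const i ((\<lambda>_. 0)(j := z - 1))) *
      (z\<^sup>2 + of_int (a j i) * (y - 1) * z + q_const j ((\<lambda>_. 0)(i := y - 1)))"
proof -
  define w :: "'i \<Rightarrow> complex" where "w = (\<lambda>_. 0)(i := y, j := z)"
  have "down j w = (\<lambda>_. 0)(i := y, j := z - 1)" "down i w = (\<lambda>_. 0)(j := z, i := y - 1)"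
    and w': "w = (\<lambda>_. 0)(j := z, i := y)"
    using assms by (auto simp: w_def)
  then have "q i ((\<lambda>_. 0)(i := y, j := z)) * q j ((\<lambda>_. 0)(j := z, i := y)) =
    q i ((\<lambda>_. 0)(i := y, j := z - 1)) * q j ((\<lambda>_. 0)(j := z, i := y - 1))"
    using exch[OF assms, of w] by (metis w_def)
  then show ?thesis
    unfolding q_plane[OF assms] q_plane[OF assms[symmetric]] by (simp only: minus_mult_minus)
qed

lemma q_const_plane_poly:
  assumes "i \<noteq> j"
  obtains p where "\<And>z. q_const i ((\<lambda>_. 0)(j := z)) = poly p z" "p \<noteq> 0 \<Longrightarrow> int (degree p) = - a j i"
proof -
  obtain p where p: "\<And>z. q i ((\<lambda>_. 0)(j := z)) = poly p z"
    using line_poly_coordinate[OF lp] by blast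
  have z: "((\<lambda>_. 0)(j := z))(i := 0) = (\<lambda>_. 0)(j := z)" for z :: complex using assms by auto
  have "p \<noteq> 0 \<Longrightarrow> int (degree p) = - a j i"
    using degree_q[of j i "\<lambda>_. 0" p] assms p by auto
  then show ?thesis
    by (intro that[of "- p"]) (auto simp: q_const_def z p)
qed

lemma isolated_edge_1_4:
  assumes "i \<noteq> j" "a i j = - 1" "a j i = - 4"
  shows False
proof -
  obtain p where p: "\<And>z. q_const j ((\<lambda>_. 0)(i := z)) = poly p z" "p \<noteq> 0 \<Longrightarrow> int (degree p) = - a i j"
    using q_const_plane_poly[OF assms(1)[symmetric]] by metis
  have "degree p \<le> 2" "coeff p 2 = 0"
    using p(2) assms(2) by (cases "p = 0"; simp add: coeff_eq_0)+
  then have "q_const j ((\<lambda>_. 0)(i := z)) = coeff p 1 * z + coeff p 0" for z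
    using poly_degree_le_2[of p] p(1) by simp
  then show False
    using plane_identity[OF assms(1)] assms
    by (intro edge_1_4_identity[of "\<lambda>z. q_const i ((\<lambda>_. 0)(j := z))" "coeff p 1" "coeff p 0"]) (simp add: algebra_simps)
qed

lemma isolated_edge_2_2:
  assumes "i \<noteq> j" "a i j = - 2" "a j i = - 2"
  shows False
proof -
  have *: "\<exists>e f g. \<forall>z. q_const i ((\<lambda>_. 0)(j := z)) = e * z\<^sup>2 + f * z + g"
    if ij: "i \<noteq> j" and a: "a j i = - 2" for i j
  proof -
    obtain p where p: "\<And>z. q_const i ((\<lambda>_. 0)(j := z)) = poly p z" "p \<noteq> 0 \<Longrightarrow> int (degree p) = - a j i"
      using q_const_plane_poly[OF ij] by metis
    have "degree p \<le> 2"
      using p(2) a by (cases "p = 0") auto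
    then show ?thesis using p(1) poly_degree_le_2[of p] by auto
  qed
  obtain e f g where E1: "\<And>z. q_const i ((\<lambda>_. 0)(j := z)) = e * z\<^sup>2 + f * z + g"
    using *[OF assms(1,3)] by blast
  obtain e' f' g' where E2: "\<And>z. q_const j ((\<lambda>_. 0)(i := z)) = e' * z\<^sup>2 + f' * z + g'"
    using *[OF assms(1)[symmetric] assms(2)] by blast
  show False
  proof (rule edge_2_2_identity)
    fix y z
    have s: "x\<^sup>2 + of_int (- 2) * t * x = x\<^sup>2 - 2 * x * t" for x t :: complex by simp
    show "(y\<^sup>2 - 2 * y * z + (e * z\<^sup>2 + f * z + g)) * (z\<^sup>2 - 2 * z * y + (e' * y\<^sup>2 + f' * y + g')) =
      (y\<^sup>2 - 2 * y * (z - 1) + (e * (z - 1)\<^sup>2 + f * (z - 1) + g)) *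
      (z\<^sup>2 - 2 * z * (y - 1) + (e' * (y - 1)\<^sup>2 + f' * (y - 1) + g'))"
      using plane_identity[OF assms(1), of y z] unfolding E1 E2 assms(2,3) s .
  qed
qed

text \<open>The null vector \<open>u\<close> forces the product of the two entries to be 4. This
  leaves -1 with -4, in either order, and -2 with -2, each refuted by its identity.\<close>

lemma isolated_edge:
  assumes N: "nbrs i = {j}" "nbrs j = {i}"
    and u: "\<And>i. u i > (0::real)" "\<And>i. (\<Sum>j\<in>UNIV. of_int (a i j) * u j) = 0"
  shows False
proof -
  have row: "2 * u i + of_int (a i j) * u j = 0" if N: "nbrs i = {j}" for i j
  proof -
    have "i \<noteq> j" using N by (auto simp: nbrs_def)
    have "(\<Sum>j\<in>UNIV. of_int (a i j) * u j) = (\<Sum>m\<in>{i,j}. of_int (a i m) * u m)"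
      using N by (intro sum.mono_neutral_right) (auto simp: nbrs_def)
    then show ?thesis using u(2)[of i] \<open>i \<noteq> j\<close> by simp
  qed
  have ij: "i \<noteq> j" using N by (auto simp: nbrs_def)
  have "of_int (a i j) * of_int (a j i) * u j = 4 * u j"
    using row[OF N(1)] row[OF N(2)] by algebra
  then have "of_int (a i j * a j i) = (4::real)" using u(1)[of j] by simp
  then have p: "a i j * a j i = 4" by (simp only: of_int_eq_numeral_iff)
  have neg: "a i j < 0" "a j i < 0"
    using nonpos[OF ij] nonpos[OF ij[symmetric]] p by (auto simp: less_le)
  have "a i j \<ge> - 4"
  proof (rule ccontr)
    assume "\<not> ?thesis"
    then have "(- a i j) * (- a j i) \<ge> 5 * 1" using neg by (intro mult_mono) auto
    then show False using p by simp
  qed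
  then have "a i j \<in> {-4, -3, -2, -1}" using neg by auto
  then have "(a i j = -1 \<and> a j i = -4) \<or> (a i j = -2 \<and> a j i = -2) \<or> (a j i = -1 \<and> a i j = -4)"
    using p by (auto; presburger)
  then show False
    using isolated_edge_1_4 isolated_edge_2_2 ij by metis
qed

text \<open>As \<open>j\<close> has two neighbours, \<open>a i j\<close> is -1 and
  \<open>q j\<close> splits, while \<open>q i\<close> does not depend on \<open>y k\<close>.
  Choosing \<open>y k\<close> so that the factor of the edge to \<open>k\<close> is nonzero, one can
  cancel it in \<open>exch\<close> and reach \<open>end_edge_identity\<close>.\<close>

lemma end_edge:
  assumes N: "nbrs i = {j}" "nbrs j = {i, k}" and "k \<noteq> i"
    and f: "\<And>y. q j y = - ((y j + of_int (a j i) * y i + c) * (y j + of_int (a j k) * y k + d))"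
  shows "a j i = -1 \<or> (a j i = -2 \<and> c = - 3/2)"
proof -
  have ne: "i \<noteq> j" "k \<noteq> j" and nz: "a j i \<noteq> 0" "a j k \<noteq> 0"
    using N by (auto simp: nbrs_def)
  have ij: "a i j = - 1" using interior_column[of j i k] N \<open>k \<noteq> i\<close> by simp
  have ik: "a i k = 0" using N \<open>k \<noteq> i\<close> ne by (auto simp: nbrs_def)
  define p where "p = (- of_int (a j i) :: complex)"
  have "(t\<^sup>2 - t * z + q_const i ((\<lambda>_. 0)(j := z))) * (z + c - p * t) =
      (t\<^sup>2 - t * (z - 1) + q_const i ((\<lambda>_. 0)(j := z - 1))) * (z + c + p - p * t)" for t z
  proof -
    obtain v where v: "of_int (a j k) * v + (z + d) \<noteq> 0"
      using exists_nonvanishing[of "of_int (a j k)" "of_int (a j k)"] nz by auto metis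
    define w where "w = ((\<lambda>_. 0)(i := t, j := z))(k := v)"
    have d: "down j w = ((\<lambda>_. 0)(i := t, j := z - 1))(k := v)"
      using ne by (auto simp: w_def)
    have qi: "q i w = - (t\<^sup>2 - z * t + q_const i ((\<lambda>_. 0)(j := z)))"
      "q i (down j w) = - (t\<^sup>2 - (z - 1) * t + q_const i ((\<lambda>_. 0)(j := z - 1)))"
      unfolding d unfolding w_def q_independent[OF \<open>k \<noteq> i\<close> ik] q_plane[OF ne(1)] ij by (simp_all add: algebra_simps)
    have qj: "q j w = - ((z + c - p * t) * (of_int (a j k) * v + (z + d)))"
      "q j (down i w) = - ((z + c + p - p * t) * (of_int (a j k) * v + (z + d)))"
      unfolding f p_def using ne \<open>k \<noteq> i\<close> by (simp_all add: w_def algebra_simps)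
    have "(t\<^sup>2 - z * t + q_const i ((\<lambda>_. 0)(j := z))) * (z + c - p * t) * (of_int (a j k) * v + (z + d)) =
      (t\<^sup>2 - (z - 1) * t + q_const i ((\<lambda>_. 0)(j := z - 1))) * (z + c + p - p * t) * (of_int (a j k) * v + (z + d))"
      using exch[OF ne(1), of w] unfolding qi qj by (simp only: minus_mult_minus mult.assoc)
    then show ?thesis using v by (simp add: mult.commute[of t])
  qed
  then have "p = 1 \<or> (p = 2 \<and> c = - 3/2)"
    using nz by (intro end_edge_identity[of p "\<lambda>z. q_const i ((\<lambda>_. 0)(j := z))"]) (auto simp: p_def)
  moreover have "p = of_int (- a j i)" by (simp add: p_def)
  moreover have "of_int (- a j i) = (1::complex) \<Longrightarrow> - a j i = 1" "of_int (- a j i) = (2::complex) \<Longrightarrow> - a j i = 2"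
    by (simp_all only: of_int_eq_1_iff of_int_eq_numeral_iff)
  ultimately show ?thesis by auto
qed

text \<open>At \<open>y i = y j = 0\<close> the factors belonging to the two outer edges survive
  both shifts unchanged and cancel, which leaves c c' = (c + 1) (c' + 1).\<close>

lemma inner_edge:
  assumes N: "nbrs i = {j, k}" "j \<noteq> k" "nbrs j = {i, m}" "m \<noteq> i"
    and fi: "\<And>y. q i y = - ((y i + of_int (a i j) * y j + c) * (y i + of_int (a i k) * y k + d))"
    and fj: "\<And>y. q j y = - ((y j + of_int (a j i) * y i + c') * (y j + of_int (a j m) * y m + d'))"
  shows "c + c' = - 1"
proof -
  have ne: "i \<noteq> j" "k \<noteq> i" "m \<noteq> j" and nz: "a i k \<noteq> 0" "a j m \<noteq> 0"
    using N by (auto simp: nbrs_def)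
  have 1: "a i j = - 1" "a j i = - 1"
    using interior_column[of j i m] interior_column[of i j k] N by auto
  obtain v where v: "of_int (a i k) * v + d \<noteq> 0" "of_int (a j m) * v + d' \<noteq> 0"
    using exists_nonvanishing[of "of_int (a i k)" "of_int (a j m)"] nz by auto
  \<comment> \<open>In a triangle \<open>k\<close> and \<open>m\<close> coincide, so a single value
    \<open>v\<close> has to serve both outer factors.\<close>
  define w where "w = (\<lambda>l. if l = i \<or> l = j then 0 else v)"
  have "c * c' * ((of_int (a i k) * v + d) * (of_int (a j m) * v + d')) =
    (c + 1) * (c' + 1) * ((of_int (a i k) * v + d) * (of_int (a j m) * v + d'))"
    using exch[OF ne(1), of w] unfolding fi fj 1
    using ne N(2,4) by (simp add: w_def algebra_simps)
  then have "c * c' = (c + 1) * (c' + 1)" using v by simp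
  then show ?thesis by (simp add: algebra_simps eq_neg_iff_add_eq_0)
qed

section \<open>Summation of the constants over the diagram\<close>

text \<open>The value 0 at end vertices is a convention: it makes the sum over \<open>nbrs i\<close> vanish everywhere.\<close>

definition edge_constants :: "'i \<Rightarrow> ('i \<Rightarrow> complex) \<Rightarrow> bool" where
  "edge_constants i c \<longleftrightarrow> (\<Sum>j\<in>nbrs i. c j) = 0 \<and> (card (nbrs i) \<noteq> 2 \<longrightarrow> (\<forall>j. c j = 0)) \<and>
     (\<forall>j k. nbrs i = {j, k} \<longrightarrow> j \<noteq> k \<longrightarrow>
       (\<forall>y. q i y = - ((y i + of_int (a i j) * y j + c j) * (y i + of_int (a i k) * y k + c k))))"

lemma edge_constants_exist: "\<exists>c. edge_constants i c"
proof (cases "card (nbrs i) = 2")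
  case True
  then obtain j k where jk: "nbrs i = {j, k}" "j \<noteq> k" by (auto simp: card_2_iff)
  obtain c d where cd: "c + d = 0"
    and f: "\<And>y. q i y = - ((y i + of_int (a i j) * y j + c) * (y i + of_int (a i k) * y k + d))"
    using factorization[OF jk] by metis
  have "edge_constants i (\<lambda>l. if l = j then c else d)"
    unfolding edge_constants_def
  proof (intro conjI allI impI)
    fix j' k' y assume "nbrs i = {j', k'}" "j' \<noteq> k'"
    then have "(j' = j \<and> k' = k) \<or> (j' = k \<and> k' = j)" using jk by (auto simp: doubleton_eq_iff)
    then show "q i y = - ((y i + of_int (a i j') * y j' + (if j' = j then c else d)) *
        (y i + of_int (a i k') * y k' + (if k' = j then c else d)))"
      using f[of y] jk(2) by (auto simp: mult.commute)
  qed (use True jk cd in auto)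
  then show ?thesis by blast
next
  case False
  then have "edge_constants i (\<lambda>_. 0)" unfolding edge_constants_def by auto
  then show ?thesis by blast
qed

lemma affine_contradiction:
  assumes u: "\<And>i. u i > (0::real)" "\<And>i. (\<Sum>j\<in>UNIV. of_int (a i j) * u j) = 0"
  shows False
proof -
  obtain c where c: "\<And>i. edge_constants i (c i)"
    using edge_constants_exist by metis
  have c0: "(\<Sum>j\<in>nbrs i. c i j) = 0" "card (nbrs i) \<noteq> 2 \<Longrightarrow> c i j = 0" for i j
    using c[of i] unfolding edge_constants_def by blast+
  have cf: "q i y = - ((y i + of_int (a i j) * y j + c i j) * (y i + of_int (a i k) * y k + c i k))"
    if "nbrs i = {j, k}" "j \<noteq> k" for i j k y
    using c[of i] that unfolding edge_constants_def by blast
  have other: "\<exists>k. nbrs j = {i, k} \<and> k \<noteq> i" if "i \<in> nbrs j" "nbrs j \<noteq> {i}" for i j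
  proof -
    have "card (nbrs j) \<noteq> 0" using that(1) by auto
    moreover have "card (nbrs j) \<noteq> 1" using that by (auto simp: card_1_singleton_iff)
    ultimately have "card (nbrs j) = 2" using card_nbrs[of j] by linarith
    then show ?thesis using that(1) by (auto simp: card_2_iff)
  qed
  \<comment> \<open>If the neighbour of an end vertex were an end vertex too, the two would form an
    isolated edge.\<close>
  have endv: "\<exists>k. nbrs j = {i, k} \<and> k \<noteq> i" if "nbrs i = {j}" for i j
  proof (rule other)
    show "i \<in> nbrs j" using that nbrs_sym by blast
    show "nbrs j \<noteq> {i}" using isolated_edge[OF that _ u] by blast
  qed
  have e: "a j i = -1 \<or> (a j i = -2 \<and> c j i = - 3/2)" if "nbrs i = {j}" for i j
    using endv[OF that] end_edge[OF that] cf by metis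
  define s where "s i = (\<Sum>j\<in>UNIV. a j i)" for i
  have s: "s i = 2 + (\<Sum>j\<in>nbrs i. a j i)" for i
  proof -
    have "s i = (\<Sum>j\<in>insert i (nbrs i). a j i)"
      unfolding s_def using zero_sym by (intro sum.mono_neutral_right) (auto simp: nbrs_def)
    then show ?thesis by (subst (asm) sum.insert) (auto simp: nbrs_def)
  qed
  have cases: "nbrs i = {} \<or> (\<exists>j. nbrs i = {j}) \<or> (\<exists>j k. nbrs i = {j, k} \<and> j \<noteq> k)" for i
  proof -
    have "card (nbrs i) = 0 \<or> card (nbrs i) = 1 \<or> card (nbrs i) = 2" using card_nbrs[of i] by linarith
    then show ?thesis by (auto simp: card_1_singleton_iff card_2_iff)
  qed
  \<comment> \<open>The column sum is 2 at an isolated vertex, 1 or 0 at an end vertex, and 0 at a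
    vertex with two neighbours.\<close>
  have nonneg: "0 \<le> s i" for i
    using cases[of i]
  proof (elim disjE exE conjE)
    fix j assume "nbrs i = {j}"
    then show ?thesis using e[of i j] by (auto simp: s)
  next
    fix j k assume "nbrs i = {j, k}" "j \<noteq> k"
    then show ?thesis using interior_column[of i j k] interior_column[of i k j] by (auto simp: s insert_commute)
  qed (simp add: s)
  have "(\<Sum>i\<in>UNIV. real_of_int (s i) * u i) = (\<Sum>j\<in>UNIV. \<Sum>i\<in>UNIV. of_int (a j i) * u i)"
    unfolding s_def of_int_sum sum_distrib_right by (rule sum.swap)
  also have "\<dots> = 0" using u(2) by simp
  finally have "\<forall>i\<in>UNIV. real_of_int (s i) * u i = 0"
    using nonneg u(1) by (subst (asm) sum_nonneg_eq_0_iff) (auto intro!: mult_nonneg_nonneg simp: less_imp_le)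
  then have s0: "s i = 0" for i using u(1)[of i] by auto
  have ne: "nbrs i \<noteq> {}" for i using s0[of i] by (auto simp: s)
  \<comment> \<open>A zero column sum at the end vertex excludes \<open>a j i = -1\<close>; the
    constant \<open>c i j\<close> is 0 by convention.\<close>
  have end_c: "c i j + c j i = - 3/2" if "nbrs i = {j}" for i j
    using e[OF that] s0[of i] that c0(2)[of i j] by (auto simp: s)
  have edge: "Re (c i j + c j i) < 0" if ji: "j \<in> nbrs i" for i j
  proof (cases "nbrs i = {j} \<or> nbrs j = {i}")
    case True
    then have "c i j + c j i = - 3/2" using end_c[of i j] end_c[of j i] by (auto simp: add.commute)
    then show ?thesis by simp
  next
    case False
    have "i \<in> nbrs j" using ji nbrs_sym by blast
    then obtain k m where N: "nbrs i = {j, k}" "k \<noteq> j" "nbrs j = {i, m}" "m \<noteq> i"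
      using other[OF ji] other[of i j] False by blast
    have "c i j + c j i = - 1"
      using inner_edge[OF N(1) N(2)[symmetric] N(3,4) cf[OF N(1) N(2)[symmetric]] cf[OF N(3) N(4)[symmetric]]] .
    then show ?thesis by simp
  qed
  \<comment> \<open>By symmetry of the neighbour relation, summing the constants at the far ends of
    the edges gives the same total as summing them vertex by vertex, which is 0.\<close>
  have "(\<Sum>i\<in>UNIV. \<Sum>j\<in>nbrs i. c j i) = (\<Sum>j\<in>UNIV. \<Sum>i\<in>nbrs j. c j i)"
  proof -
    have r: "sum f (nbrs i) = (\<Sum>j\<in>UNIV. if j \<in> nbrs i then f j else 0)" for f :: "'i \<Rightarrow> complex" and i
      by (simp add: sum.If_cases)
    show ?thesis
      unfolding r by (subst sum.swap) (intro sum.cong HOL.refl if_cong nbrs_sym)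
  qed
  then have "(\<Sum>i\<in>UNIV. \<Sum>j\<in>nbrs i. c i j + c j i) = 0"
    by (simp add: sum.distrib c0(1))
  then have "(\<Sum>i\<in>UNIV. \<Sum>j\<in>nbrs i. - Re (c i j + c j i)) = 0"
    by (metis (no_types, lifting) Re_sum sum_negf sum.cong neg_0_equal_iff_equal zero_complex.sel(1))
  moreover have "(\<Sum>i\<in>UNIV. \<Sum>j\<in>nbrs i. - Re (c i j + c j i)) > 0"
  proof (intro sum_pos)
    show "0 < - Re (c i j + c j i)" if "j \<in> nbrs i" for i j
      using edge[OF that] by (simp only: neg_0_less_iff_less)
  qed (use ne in auto)
  ultimately show False by simp
qed

end

section \<open>Modules over the Kac--Moody algebra as shift operators\<close>

context lie_algebra begin

context
  fixes I assumes I: "lie_ideal L I"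
begin

lemma ideal_congruence_iff: "(x, y) \<in> ideal_congruence L I \<longleftrightarrow> x \<in> C \<and> y \<in> C \<and> x \<oplus> (-1) \<odot> y \<in> I"
  by (simp add: ideal_congruence_def)

lemma equiv_ideal_congruence: "equiv C (ideal_congruence L I)"
proof (rule equivI)
  show "ideal_congruence L I \<subseteq> C \<times> C" by (auto simp: ideal_congruence_def)
  show "refl_on C (ideal_congruence L I)"
    using I by (auto simp: refl_on_def ideal_congruence_iff add_right_neg lie_ideal_def)
  show "sym (ideal_congruence L I)"
  proof (rule symI)
    fix x y assume "(x, y) \<in> ideal_congruence L I"
    then have xy: "x \<in> C" "y \<in> C" "x \<oplus> (-1) \<odot> y \<in> I" by (auto simp: ideal_congruence_iff)
    then have "(-1) \<odot> (x \<oplus> (-1) \<odot> y) \<in> I" using I by (auto simp: lie_ideal_def)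
    moreover have "(-1) \<odot> (x \<oplus> (-1) \<odot> y) = y \<oplus> (-1) \<odot> x"
      using xy by (simp add: smult_add add_comm)
    ultimately show "(y, x) \<in> ideal_congruence L I" using xy by (simp add: ideal_congruence_iff)
  qed
  show "trans (ideal_congruence L I)"
  proof (rule transI)
    fix x y z assume "(x, y) \<in> ideal_congruence L I" "(y, z) \<in> ideal_congruence L I"
    then have xyz: "x \<in> C" "y \<in> C" "z \<in> C" "x \<oplus> (-1) \<odot> y \<in> I" "y \<oplus> (-1) \<odot> z \<in> I"
      by (auto simp: ideal_congruence_iff)
    have "(x \<oplus> (-1) \<odot> y) \<oplus> (y \<oplus> (-1) \<odot> z) = x \<oplus> (((-1) \<odot> y \<oplus> y) \<oplus> (-1) \<odot> z)"
      using xyz by (simp add: add_assoc)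
    also have "\<dots> = x \<oplus> (-1) \<odot> z"
      using xyz by (simp add: add_neg)
    finally have "x \<oplus> (-1) \<odot> z \<in> I" using xyz I by (metis lie_ideal_def)
    then show "(x, z) \<in> ideal_congruence L I" using xyz by (simp add: ideal_congruence_iff)
  qed
qed

lemma ideal_congruence_smult:
  assumes "(x, y) \<in> ideal_congruence L I"
  shows "(c \<odot> x, c \<odot> y) \<in> ideal_congruence L I"
proof -
  have xy: "x \<in> C" "y \<in> C" "x \<oplus> (-1) \<odot> y \<in> I" using assms by (auto simp: ideal_congruence_iff)
  then have "c \<odot> (x \<oplus> (-1) \<odot> y) \<in> I" using I by (auto simp: lie_ideal_def)
  then show ?thesis using xy by (simp add: ideal_congruence_iff smult_add)
qed

lemma ideal_congruence_br:
  assumes "(x, y) \<in> ideal_congruence L I" "z \<in> C"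
  shows "(br z x, br z y) \<in> ideal_congruence L I" and "(br x z, br y z) \<in> ideal_congruence L I"
proof -
  have xy: "x \<in> C" "y \<in> C" "x \<oplus> (-1) \<odot> y \<in> I" using assms(1) by (auto simp: ideal_congruence_iff)
  then have "br z (x \<oplus> (-1) \<odot> y) \<in> I" using I assms(2) by (auto simp: lie_ideal_def)
  then show 1: "(br z x, br z y) \<in> ideal_congruence L I"
    using xy assms(2) by (simp add: ideal_congruence_iff mult_add_right mult_smult_right)
  show "(br x z, br y z) \<in> ideal_congruence L I"
    using ideal_congruence_smult[OF 1, of "-1"] xy assms(2)
    by (simp add: anticommute[of x z] anticommute[of y z])
qed

lemma quotient_algebra_simps:
  assumes "x \<in> C" "y \<in> C"
  defines "R \<equiv> ideal_congruence L I"
  shows "R `` {x} \<in> alg_carrier (quotient_algebra L R)"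
    and "alg_smult (quotient_algebra L R) c (R `` {x}) = R `` {c \<odot> x}"
    and "alg_mult (quotient_algebra L R) (R `` {x}) (R `` {y}) = R `` {br x y}"
proof -
  have e: "equiv C R" unfolding R_def by (rule equiv_ideal_congruence)
  show "R `` {x} \<in> alg_carrier (quotient_algebra L R)"
    using assms(1) by (simp add: quotient_algebra_def quotientI)
  have "congruent R (\<lambda>x. R `` {c \<odot> x})"
    using ideal_congruence_smult unfolding R_def
    by (intro congruentI equiv_class_eq[OF equiv_ideal_congruence]) auto
  then show "alg_smult (quotient_algebra L R) c (R `` {x}) = R `` {c \<odot> x}"
    using UN_equiv_class[OF e _ assms(1)] by (simp add: quotient_algebra_def)
  have "congruent2 R R (\<lambda>x y. R `` {br x y})"
    using ideal_congruence_br unfolding R_def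
    by (intro congruent2I[OF equiv_ideal_congruence equiv_ideal_congruence]
        equiv_class_eq[OF equiv_ideal_congruence]) auto
  then show "alg_mult (quotient_algebra L R) (R `` {x}) (R `` {y}) = R `` {br x y}"
    using UN_equiv_class2[OF e e _ assms(1,2)] by (simp add: quotient_algebra_def)
qed

end
end

section \<open>The enveloping algebra as an algebra of polynomial functions\<close>

definition linear_functional :: "(complex \<Rightarrow> 'h \<Rightarrow> 'h) \<Rightarrow> ('h::ab_group_add \<Rightarrow> complex) \<Rightarrow> bool" where
  "linear_functional sh \<xi> \<longleftrightarrow> (\<forall>h h'. \<xi> (h + h') = \<xi> h + \<xi> h') \<and> (\<forall>c h. \<xi> (sh c h) = c * \<xi> h)"

text \<open>For linear \<xi> this is the character of the enveloping algebra extending \<xi>;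
  \<open>eval_term_cong\<close> shows that it respects the defining relations.\<close>

fun eval_term :: "('h \<Rightarrow> complex) \<Rightarrow> 'h env_gen alg_term \<Rightarrow> complex" where
  "eval_term \<xi> (Gen Unit) = 1"
| "eval_term \<xi> (Gen (Incl h)) = \<xi> h"
| "eval_term \<xi> Zero = 0"
| "eval_term \<xi> (Add s t) = eval_term \<xi> s + eval_term \<xi> t"
| "eval_term \<xi> (Smult c t) = c * eval_term \<xi> t"
| "eval_term \<xi> (Mult s t) = eval_term \<xi> s * eval_term \<xi> t"

lemma eval_term_cong:
  assumes "linear_functional sh \<xi>" and "presented_eq (env_relation sh (\<lambda>_ _. 0)) s t"
  shows "eval_term \<xi> s = eval_term \<xi> t"
  using assms(2)
proof (induction rule: presented_eq.induct)
  case (relation s t)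
  have "\<xi> 0 = 0" using assms(1) by (metis linear_functional_def add_cancel_right_right add_0)
  with relation show ?case
    using assms(1) by cases (auto simp: linear_functional_def)
qed (auto simp: algebra_simps)

lemma eval_term_line:
  "\<exists>p. \<forall>x. eval_term (\<lambda>h. \<xi> h + x * \<mu> h) t = poly p x"
proof (induction t)
  case (Gen g)
  then show ?case
  proof (cases g)
    case Unit
    then show ?thesis by (intro exI[of _ 1]) auto
  next
    case (Incl h)
    then show ?thesis by (intro exI[of _ "[:\<xi> h, \<mu> h:]"]) auto
  qed
next
  case Zero
  then show ?case by (intro exI[of _ 0]) auto
next
  case (Add s t)
  then obtain p r where "\<forall>x. eval_term (\<lambda>h. \<xi> h + x * \<mu> h) s = poly p x"
    "\<forall>x. eval_term (\<lambda>h. \<xi> h + x * \<mu> h) t = poly r x" by (elim exE)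
  then show ?case by (intro exI[of _ "p + r"]) simp
next
  case (Smult c t)
  then obtain p where "\<forall>x. eval_term (\<lambda>h. \<xi> h + x * \<mu> h) t = poly p x" by (elim exE)
  then show ?case by (intro exI[of _ "smult c p"]) simp
next
  case (Mult s t)
  then obtain p r where "\<forall>x. eval_term (\<lambda>h. \<xi> h + x * \<mu> h) s = poly p x"
    "\<forall>x. eval_term (\<lambda>h. \<xi> h + x * \<mu> h) t = poly r x" by (elim exE)
  then show ?case by (intro exI[of _ "p * r"]) simp
qed

lemma presented_eq_smult_0: "presented_eq rel (Smult 0 x) Zero"
proof -
  have "presented_eq rel (Smult (-1 + 1) x) (Add (Smult (-1) x) (Smult 1 x))"
    by (rule presented_eq.add_smult)
  moreover have "presented_eq rel (Add (Smult (-1) x) (Smult 1 x)) (Add (Smult (-1) x) x)"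
    by (rule presented_eq.cong_add[OF presented_eq.refl presented_eq.smult_one])
  ultimately have "presented_eq rel (Smult (-1 + 1) x) Zero"
    by (rule presented_eq.trans[OF presented_eq.trans presented_eq.add_neg])
  then show ?thesis by simp
qed

lemma presented_eq_mult_zero: "presented_eq rel (Mult Zero x) Zero"
proof -
  have "presented_eq rel (Mult Zero x) (Mult (Smult 0 x) x)"
    by (intro presented_eq.cong_mult presented_eq.refl presented_eq.sym[OF presented_eq_smult_0])
  moreover have "presented_eq rel (Mult (Smult 0 x) x) (Smult 0 (Mult x x))"
    by (rule presented_eq.mult_smult_left)
  ultimately show ?thesis
    by (rule presented_eq.trans[OF presented_eq.trans presented_eq_smult_0])
qed

locale free_action =
  fixes sh :: "complex \<Rightarrow> 'h::ab_group_add \<Rightarrow> 'h"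
    and s :: "complex \<Rightarrow> 'v::ab_group_add \<Rightarrow> 'v" and Z :: "'h \<Rightarrow> 'v \<Rightarrow> 'v"
    and \<phi> :: "'v \<Rightarrow> 'h env_gen alg_term set"
  assumes s_zero: "s 0 v = 0" and s_minus: "s (-1) v = - v"
    and bij: "bij_betw \<phi> UNIV (alg_carrier (enveloping_algebra sh (\<lambda>_ _. 0)))"
    and \<phi>_add: "\<phi> (v + w) = alg_add (enveloping_algebra sh (\<lambda>_ _. 0)) (\<phi> v) (\<phi> w)"
    and \<phi>_smult: "\<phi> (s c v) = alg_smult (enveloping_algebra sh (\<lambda>_ _. 0)) c (\<phi> v)"
    and \<phi>_Z: "\<phi> (Z h v) = alg_mult (enveloping_algebra sh (\<lambda>_ _. 0)) (env_incl sh (\<lambda>_ _. 0) h) (\<phi> v)"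
begin

abbreviation eq where "eq \<equiv> presented_eq (env_relation sh (\<lambda>_ _. 0))"

definition cl where "cl t = presented_rel (env_relation sh (\<lambda>_ _. 0)) `` {t}"

lemma cl_eq_iff: "cl t = cl u \<longleftrightarrow> eq t u"
  unfolding cl_def by (rule presented_class_eq_iff)

lemma eq_rel: "env_relation sh (\<lambda>_ _. 0) x y \<Longrightarrow> cl x = cl y"
  unfolding cl_eq_iff by (rule presented_eq.relation)

lemma \<phi>_surj: "\<exists>t. \<phi> v = cl t"
proof -
  have "\<phi> v \<in> alg_carrier (enveloping_algebra sh (\<lambda>_ _. 0))" using bij by (auto simp: bij_betw_def)
  then show ?thesis by (auto simp: enveloping_algebra_def presented_algebra_simps cl_def)
qed

lemma \<phi>_inj: "\<phi> v = \<phi> w \<Longrightarrow> v = w"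
  using bij by (auto simp: bij_betw_def inj_def)

lemma \<phi>_cl:
  "\<phi> v = cl t \<Longrightarrow> \<phi> w = cl u \<Longrightarrow> \<phi> (v + w) = cl (Add t u)"
  "\<phi> v = cl t \<Longrightarrow> \<phi> (s c v) = cl (Smult c t)"
  "\<phi> v = cl t \<Longrightarrow> \<phi> (Z h v) = cl (Mult (Gen (Incl h)) t)"
  by (simp_all add: \<phi>_add \<phi>_smult \<phi>_Z env_incl_def cl_def enveloping_algebra_def presented_algebra_simps)

lemma \<phi>_zero: "\<phi> 0 = cl Zero"
proof -
  obtain t where "\<phi> 0 = cl t" using \<phi>_surj by blast
  then have "\<phi> (s 0 0) = cl (Smult 0 t)" by (rule \<phi>_cl)
  then show ?thesis unfolding s_zero using presented_eq_smult_0 cl_eq_iff by metis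
qed

text \<open>Acting by terms rather than by classes allows an operator to be moved past the action by
  structural induction.\<close>

fun act :: "'h env_gen alg_term \<Rightarrow> 'v \<Rightarrow> 'v" where
  "act (Gen Unit) w = w"
| "act (Gen (Incl h)) w = Z h w"
| "act Zero w = 0"
| "act (Add t u) w = act t w + act u w"
| "act (Smult c t) w = s c (act t w)"
| "act (Mult t u) w = act t (act u w)"

lemma \<phi>_act: "\<phi> w = cl u \<Longrightarrow> \<phi> (act t w) = cl (Mult t u)"
proof (induction t arbitrary: w u)
  case (Gen g)
  show ?case
  proof (cases g)
    case Unit
    then show ?thesis using Gen eq_rel[OF env_relation.unit_left] by simp
  next
    case (Incl h)
    then show ?thesis using Gen \<phi>_cl(3) by simp
  qed
next
  case Zero
  have "cl Zero = cl (Mult Zero u)"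
    unfolding cl_eq_iff by (rule presented_eq.sym[OF presented_eq_mult_zero])
  then show ?case by (simp add: \<phi>_zero)
next
  case (Add t t')
  have "\<phi> (act t w + act t' w) = cl (Add (Mult t u) (Mult t' u))"
    using Add by (intro \<phi>_cl) auto
  also have "\<dots> = cl (Mult (Add t t') u)"
    unfolding cl_eq_iff by (rule presented_eq.sym[OF presented_eq.mult_add_left])
  finally show ?case by simp
next
  case (Smult c t)
  have "\<phi> (s c (act t w)) = cl (Smult c (Mult t u))"
    using Smult by (intro \<phi>_cl) auto
  also have "\<dots> = cl (Mult (Smult c t) u)"
    unfolding cl_eq_iff by (rule presented_eq.sym[OF presented_eq.mult_smult_left])
  finally show ?case by simp
next
  case (Mult t t')
  have "\<phi> (act t (act t' w)) = cl (Mult t (Mult t' u))"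
    using Mult by blast
  also have "\<dots> = cl (Mult (Mult t t') u)"
    by (rule eq_rel[OF env_relation.assoc, symmetric])
  finally show ?case by simp
qed

definition one :: 'v where "one = (SOME v. \<phi> v = cl (Gen Unit))"

lemma \<phi>_one: "\<phi> one = cl (Gen Unit)"
proof -
  have "cl (Gen Unit) \<in> \<phi> ` UNIV"
    using bij by (auto simp: bij_betw_def enveloping_algebra_def presented_algebra_simps cl_def)
  then have "\<exists>v. \<phi> v = cl (Gen Unit)" by auto
  then show ?thesis unfolding one_def by (rule someI_ex)
qed

lemma act_one: "\<phi> v = cl t \<Longrightarrow> act t one = v"
  by (rule \<phi>_inj) (simp add: \<phi>_act[OF \<phi>_one] eq_rel[OF env_relation.unit_right])

text \<open>\<open>val v\<close> is the polynomial function on the dual of the Cartan subalgebra corresponding to \<open>v\<close>.\<close>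

definition val :: "'v \<Rightarrow> ('h \<Rightarrow> complex) \<Rightarrow> complex" where
  "val v \<xi> = eval_term \<xi> (SOME t. \<phi> v = cl t)"

lemma val_line: "\<exists>p. \<forall>x. val v (\<lambda>h. \<xi> h + x * \<mu> h) = poly p x"
  unfolding val_def by (rule eval_term_line)

context
  fixes \<xi> assumes \<xi>: "linear_functional sh \<xi>"
begin

lemma val_eq: "\<phi> v = cl t \<Longrightarrow> val v \<xi> = eval_term \<xi> t"
  unfolding val_def
  by (rule eval_term_cong[OF \<xi>]) (metis (mono_tags, lifting) cl_eq_iff someI)

lemma val_simps [simp]:
  "val (v + w) \<xi> = val v \<xi> + val w \<xi>" "val (s c v) \<xi> = c * val v \<xi>"
  "val (Z h v) \<xi> = \<xi> h * val v \<xi>" "val 0 \<xi> = 0"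
proof -
  obtain t u where tu: "\<phi> v = cl t" "\<phi> w = cl u" using \<phi>_surj by metis
  show "val (v + w) \<xi> = val v \<xi> + val w \<xi>" "val (s c v) \<xi> = c * val v \<xi>"
    "val (Z h v) \<xi> = \<xi> h * val v \<xi>"
    using val_eq[OF tu(1)] val_eq[OF tu(2)] val_eq[OF \<phi>_cl(1)[OF tu]] val_eq[OF \<phi>_cl(2)[OF tu(1)]]
      val_eq[OF \<phi>_cl(3)[OF tu(1)]] by simp_all
  show "val 0 \<xi> = 0" using val_eq[OF \<phi>_zero] by simp
qed

lemma val_diff [simp]: "val (v - w) \<xi> = val v \<xi> - val w \<xi>"
  using val_simps(1)[of v "s (-1) w"] val_simps(2)[of "-1" w] by (simp add: s_minus)

text \<open>Moving \<open>X\<close> past \<open>Z h\<close> replaces the scalar \<xi>(h) by \<xi>(h)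
  - \<beta>(h), so induction over the term representing \<open>v\<close> shows that \<open>X\<close>
  is a shift by \<beta> followed by multiplication with the function of
  \<open>X one\<close>.\<close>

lemma val_weight_operator:
  assumes "\<And>v w. X (v + w) = X v + X w" "\<And>c v. X (s c v) = s c (X v)"
    and "\<And>h v. Z h (X v) - X (Z h v) = s (\<beta> h) (X v)"
    and \<beta>: "linear_functional sh (\<lambda>h. \<xi> h - \<beta> h)"
  shows "val (X v) \<xi> = val (X one) \<xi> * val v (\<lambda>h. \<xi> h - \<beta> h)"
proof -
  have X0: "X 0 = 0" using assms(2)[of 0 0] by (simp add: s_zero)
  have XZ: "X (Z h v) = Z h (X v) - s (\<beta> h) (X v)" for h v
    using assms(3)[of h v] by (simp add: algebra_simps)
  have *: "val (X (act t w)) \<xi> = eval_term (\<lambda>h. \<xi> h - \<beta> h) t * val (X w) \<xi>" for t w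
  proof (induction t arbitrary: w)
    case (Gen g)
    show ?case by (cases g) (simp_all add: XZ algebra_simps)
  qed (simp_all add: assms(1,2) X0 algebra_simps)
  obtain t where t: "\<phi> v = cl t" using \<phi>_surj by blast
  have "val v (\<lambda>h. \<xi> h - \<beta> h) = eval_term (\<lambda>h. \<xi> h - \<beta> h) t"
    unfolding val_def by (rule eval_term_cong[OF \<beta>]) (metis (mono_tags, lifting) cl_eq_iff someI t)
  then show ?thesis using *[of t one] act_one[OF t] by (simp add: mult.commute)
qed

end
end

section \<open>From a module to the shift equations\<close>

text \<open>Values on the coroots can be prescribed because these are independent. The functional
  serves as the base point for the coordinates of \<open>shift_system\<close>.\<close>

lemma coroots_dual_functional:
  assumes "realization A sh \<alpha> \<alpha>v"
  shows "\<exists>\<xi>. linear_functional sh \<xi> \<and> (\<forall>i. \<xi> (\<alpha>v i) = 1)"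
proof -
  interpret vector_space sh
    using assms by (auto simp: realization_def finite_dimensional_vector_space_def)
  interpret V: vector_space_pair sh "(*) :: complex \<Rightarrow> complex \<Rightarrow> complex"
    by unfold_locales (simp_all add: algebra_simps)
  have li: "\<And>c. (\<Sum>i\<in>UNIV. sh (c i) (\<alpha>v i)) = 0 \<Longrightarrow> \<forall>i. c i = 0"
    using assms by (auto simp: realization_def)
  have inj: "inj \<alpha>v"
  proof (rule injI, rule ccontr)
    fix i j assume ij: "\<alpha>v i = \<alpha>v j" "i \<noteq> j"
    have "(\<Sum>k\<in>UNIV. sh ((if k = i then 1 else 0) - (if k = j then 1 else 0)) (\<alpha>v k)) = 0"
      using ij(1) by (simp add: scale_left_diff_distrib sum_subtractf if_distrib[of "\<lambda>c. sh c _"] cong: if_cong)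
    from li[OF this] ij(2) show False by (auto dest: spec[of _ i])
  qed
  have "independent (range \<alpha>v)"
  proof (rule independent_if_scalars_zero)
    fix f x assume s: "(\<Sum>x\<in>range \<alpha>v. sh (f x) x) = 0" and x: "x \<in> range \<alpha>v"
    have "(\<Sum>i\<in>UNIV. sh (f (\<alpha>v i)) (\<alpha>v i)) = 0"
      using s by (simp add: sum.reindex[OF inj])
    then have "\<forall>i. f (\<alpha>v i) = 0" by (rule li)
    then show "f x = 0" using x by auto
  qed simp
  from V.linear_independent_extend[OF this, of "\<lambda>_. 1"]
  obtain g where "Vector_Spaces.linear sh (*) g" "\<forall>x\<in>range \<alpha>v. g x = 1" by blast
  then show ?thesis by (auto simp: linear_functional_def Vector_Spaces.linear_iff)
qed

text \<open>Pulling the action back along the quotient map turns the defining relations of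
  \<open>tilde_algebra\<close> into operator identities; the map respects brackets because
  \<open>km_radical\<close> is an ideal.\<close>

lemma category_H_operators:
  fixes A :: "int^'i^'i" and \<alpha>v :: "'i \<Rightarrow> 'h::ab_group_add"
    and s :: "complex \<Rightarrow> 'v::ab_group_add \<Rightarrow> 'v"
  assumes "realization A sh \<alpha> \<alpha>v" and "(s, \<rho>) \<in> category_H sh \<alpha> \<alpha>v"
  obtains X Y :: "'i \<Rightarrow> 'v \<Rightarrow> 'v" and Z \<phi> where "free_action sh s Z \<phi>"
    and "\<And>i v w. X i (v + w) = X i v + X i w" "\<And>i c v. X i (s c v) = s c (X i v)"
    and "\<And>i v w. Y i (v + w) = Y i v + Y i w" "\<And>i c v. Y i (s c v) = s c (Y i v)"
    and "\<And>i h v. Z h (X i v) - X i (Z h v) = s (\<alpha> i h) (X i v)"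
    and "\<And>i h v. Z h (Y i v) - Y i (Z h v) = s (- \<alpha> i h) (Y i v)"
    and "\<And>i j v. X i (Y j v) - Y j (X i v) = (if i = j then Z (\<alpha>v i) v else 0)"
proof -
  let ?L = "tilde_algebra sh \<alpha> \<alpha>v"
  let ?e = "\<lambda>i. presented_rel (km_relation sh \<alpha> \<alpha>v) `` {Gen (E i)}"
  let ?f = "\<lambda>i. presented_rel (km_relation sh \<alpha> \<alpha>v) `` {Gen (F i)}"
  interpret chevalley ?L sh \<alpha> \<alpha>v ?e ?f "tilde_cartan sh \<alpha> \<alpha>v"
    by (rule chevalley_tilde)
  let ?R = "ideal_congruence ?L (km_radical sh \<alpha> \<alpha>v)"
  let ?g = "kac_moody_algebra sh \<alpha> \<alpha>v"
  have "lie_ideal ?L (km_radical sh \<alpha> \<alpha>v)"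
    unfolding km_radical_eq[OF assms(1)]
    by (rule greatest_cartan_trivial_ideal[OF assms(1), unfolded cartan_trivial_ideal_def[of _ _ _ "\<Union> _"], THEN conjunct1])
  note Q = quotient_algebra_simps[OF this, folded kac_moody_algebra_def]
  have mod: "lie_module ?g s \<rho>" and free: "free_rank_one sh s (\<lambda>h. \<rho> (cartan_embedding sh \<alpha> \<alpha>v h))"
    using assms(2) by (auto simp: category_H_def)
  interpret V: vector_space s using mod by (simp add: lie_module_def)
  define T where "T x = \<rho> (?R `` {x})" for x
  have TZ: "\<rho> (cartan_embedding sh \<alpha> \<alpha>v h) = T (tilde_cartan sh \<alpha> \<alpha>v h)" for h
    by (simp add: T_def cartan_embedding_def)
  have lin: "T x (v + w) = T x v + T x w" "T x (s c v) = s c (T x v)" if "x \<in> alg_carrier ?L" for x c v w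
    using mod Q(1)[OF that that] unfolding lie_module_def T_def
    by (auto simp: Vector_Spaces.linear_iff)
  have sm: "T (alg_smult ?L c x) v = s c (T x v)" if "x \<in> alg_carrier ?L" for c x v
    using mod Q(1)[OF that that] Q(2)[OF that that, symmetric] unfolding lie_module_def T_def by simp
  have br: "T (alg_mult ?L x y) v = T x (T y v) - T y (T x v)" if "x \<in> alg_carrier ?L" "y \<in> alg_carrier ?L" for x y v
    using mod Q(1)[OF that] Q(1)[OF that(2,1)] Q(3)[OF that, symmetric] unfolding lie_module_def T_def by simp
  have T0: "T (alg_zero ?L) v = 0" for v
    using sm[OF zero_closed, of 0 v] by simp
  obtain \<phi> where \<phi>: "free_action sh s (\<lambda>h. T (tilde_cartan sh \<alpha> \<alpha>v h)) \<phi>"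
  proof -
    obtain \<phi> where "bij_betw \<phi> UNIV (alg_carrier (enveloping_algebra sh (\<lambda>_ _. 0)))"
      "\<forall>v w. \<phi> (v + w) = alg_add (enveloping_algebra sh (\<lambda>_ _. 0)) (\<phi> v) (\<phi> w)"
      "\<forall>c v. \<phi> (s c v) = alg_smult (enveloping_algebra sh (\<lambda>_ _. 0)) c (\<phi> v)"
      "\<forall>h v. \<phi> (T (tilde_cartan sh \<alpha> \<alpha>v h) v) =
        alg_mult (enveloping_algebra sh (\<lambda>_ _. 0)) (env_incl sh (\<lambda>_ _. 0) h) (\<phi> v)"
      using free unfolding free_rank_one_def Let_def TZ by blast
    then have "free_action sh s (\<lambda>h. T (tilde_cartan sh \<alpha> \<alpha>v h)) \<phi>"
      by unfold_locales auto
    then show ?thesis by (rule that)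
  qed
  show ?thesis
  proof (rule that[OF \<phi>, of "\<lambda>i. T (?e i)" "\<lambda>i. T (?f i)"])
    fix i h v
    show "T (tilde_cartan sh \<alpha> \<alpha>v h) (T (?e i) v) - T (?e i) (T (tilde_cartan sh \<alpha> \<alpha>v h) v) = s (\<alpha> i h) (T (?e i) v)"
      by (simp flip: br add: \<iota>_e sm)
    show "T (tilde_cartan sh \<alpha> \<alpha>v h) (T (?f i) v) - T (?f i) (T (tilde_cartan sh \<alpha> \<alpha>v h) v) = s (- \<alpha> i h) (T (?f i) v)"
      by (simp flip: br add: \<iota>_f sm)
  next
    fix i j v
    show "T (?e i) (T (?f j) v) - T (?f j) (T (?e i) v) = (if i = j then T (tilde_cartan sh \<alpha> \<alpha>v (\<alpha>v i)) v else 0)"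
      by (simp flip: br add: ef T0)
  qed (simp_all add: lin)
qed

lemma affine_category_H_empty:
  fixes A :: "int^'i^'i" and \<alpha>v :: "'i \<Rightarrow> 'h::ab_group_add"
    and s :: "complex \<Rightarrow> 'v::ab_group_add \<Rightarrow> 'v"
  assumes A: "affine_cartan_matrix A" and r: "realization A sh \<alpha> \<alpha>v"
  shows "(s, \<rho>) \<notin> category_H sh \<alpha> \<alpha>v"
proof
  assume "(s, \<rho>) \<in> category_H sh \<alpha> \<alpha>v"
  then obtain X Y :: "'i \<Rightarrow> 'v \<Rightarrow> 'v" and Z \<phi> where \<phi>: "free_action sh s Z \<phi>"
    and X: "\<And>i v w. X i (v + w) = X i v + X i w" "\<And>i c v. X i (s c v) = s c (X i v)"
    and Y: "\<And>i v w. Y i (v + w) = Y i v + Y i w" "\<And>i c v. Y i (s c v) = s c (Y i v)"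
    and ZX: "\<And>i h v. Z h (X i v) - X i (Z h v) = s (\<alpha> i h) (X i v)"
    and ZY: "\<And>i h v. Z h (Y i v) - Y i (Z h v) = s (- \<alpha> i h) (Y i v)"
    and XY: "\<And>i j v. X i (Y j v) - Y j (X i v) = (if i = j then Z (\<alpha>v i) v else 0)"
    by (rule category_H_operators[OF r]) (rule that)
  interpret free_action sh s Z \<phi> by (rule \<phi>)
  obtain \<xi>\<^sub>0 where \<xi>\<^sub>0: "linear_functional sh \<xi>\<^sub>0" "\<And>i. \<xi>\<^sub>0 (\<alpha>v i) = 1"
    using coroots_dual_functional[OF r] by blast
  have \<alpha>: "\<alpha> i (h + h') = \<alpha> i h + \<alpha> i h'" "\<alpha> i (sh c h) = c * \<alpha> i h"
    and \<alpha>v: "\<alpha> j (\<alpha>v i) = of_int (A $ i $ j)" for i j c h h'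
    using r by (auto simp: realization_def Vector_Spaces.linear_iff)
  \<comment> \<open>These are the points of the affine subspace through \<open>\<xi>\<^sub>0\<close>
    in the root directions; a shift by a simple root is a unit step in one coordinate.\<close>
  define pt :: "('i \<Rightarrow> complex) \<Rightarrow> 'h \<Rightarrow> complex"
    where "pt y = (\<lambda>h. \<xi>\<^sub>0 h + (\<Sum>k\<in>UNIV. y k * \<alpha> k h))" for y
  have lf: "linear_functional sh (pt y)" for y
    using \<xi>\<^sub>0(1) unfolding linear_functional_def pt_def \<alpha>
    by (simp add: distrib_left sum.distrib sum_distrib_left mult.left_commute)
  have pt_upd: "pt (y(i := y i + c)) = (\<lambda>h. pt y h + c * \<alpha> i h)" for y i c
    unfolding pt_def by (subst (1 2) sum.remove[of _ i]) (auto simp: algebra_simps intro!: ext sum.cong)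
  have down: "(\<lambda>h. pt y h - \<alpha> i h) = pt (down i y)" and up: "(\<lambda>h. pt y h - - \<alpha> i h) = pt (y(i := y i + 1))" for y i
    using pt_upd[of y i "-1"] pt_upd[of y i 1] by simp_all
  have line: "pt (\<lambda>k. y k + t * z k) = (\<lambda>h. pt y h + t * (\<Sum>k\<in>UNIV. z k * \<alpha> k h))" for y z t
    by (simp add: pt_def distrib_right sum.distrib sum_distrib_left mult.assoc add.assoc)
  define a where "a i y = val (X i one) (pt y)" for i y
  define b where "b i y = val (Y i one) (pt y)" for i y
  have vX: "val (X i v) (pt y) = a i y * val v (pt (down i y))" for i v y
    using val_weight_operator[OF lf, of "X i" "\<alpha> i" y v, OF X ZX] lf unfolding down a_def by blast
  have vY: "val (Y i v) (pt y) = b i y * val v (pt (y(i := y i + 1)))" for i v y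
    using val_weight_operator[OF lf, of "Y i" "\<lambda>h. - \<alpha> i h" y v, OF Y ZY] lf unfolding up b_def by blast
  have val_one: "val one (pt y) = 1" for y
    using val_eq[OF lf \<phi>_one] by simp
  \<comment> \<open>The relation for [e_i, f_j] is applied to \<open>one\<close> and evaluated at
    \<open>pt y\<close>.\<close>
  have ab: "a i y * b j (down i y) - b j y * a i (y(j := y j + 1)) = (if i = j then pt y (\<alpha>v i) else 0)" for i j y
  proof -
    have "val (X i (Y j one) - Y j (X i one)) (pt y) = (if i = j then pt y (\<alpha>v i) else 0)"
      unfolding XY by (simp add: val_simps[OF lf] val_one)
    then show ?thesis
      unfolding val_diff[OF lf] vX[of i "Y j one"] vY[of j "X i one"] a_def[symmetric] b_def[symmetric] .
  qed
  define q where "q i y = a i y * b i (down i y)" for i y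
  have lp: "line_poly (a i)" "line_poly (b i)" for i
    unfolding line_poly_def a_def b_def line by (intro allI val_line)+
  interpret shift_system "\<lambda>i j. A $ i $ j" q
  proof unfold_locales
    show "line_poly (q i)" for i
      unfolding q_def by (intro line_poly_mult line_poly_down lp)
    show "q i y - q i (y(i := y i + 1)) = 1 + (\<Sum>j\<in>UNIV. of_int (A $ i $ j) * y j)" for i y
    proof -
      have "down i (y(i := y i + 1)) = y" by simp
      then have "q i y - q i (y(i := y i + 1)) = pt y (\<alpha>v i)"
        using ab[of i y i] by (simp add: q_def mult.commute)
      then show ?thesis by (simp add: pt_def \<xi>\<^sub>0 \<alpha>v mult.commute)
    qed
    show "q i y * q j y = q i (down j y) * q j (down i y)" if "i \<noteq> j" for i j y
    proof -
      have rel: "a i (down j y) * b j (down i (down j y)) = b j (down j y) * a i y" if "i \<noteq> j" for i j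
        using ab[of i "down j y" j] that by simp
      \<comment> \<open>Pairing \<open>a i\<close> with \<open>b j\<close> and \<open>a j\<close>
        with \<open>b i\<close> makes the two vanishing commutators applicable.\<close>
      have "q i (down j y) * q j (down i y) =
        (a i (down j y) * b j (down i (down j y))) * (a j (down i y) * b i (down j (down i y)))"
        unfolding q_def down_commute[OF that, of y] by (simp only: ac_simps)
      also have "\<dots> = q i y * q j y"
        unfolding rel[OF that] rel[OF that[symmetric]] q_def by (simp only: ac_simps)
      finally show ?thesis ..
    qed
  qed (use A in \<open>auto simp: affine_cartan_matrix_def generalized_cartan_matrix_def\<close>)
  obtain u :: "real^'i" where u: "\<And>i. u $ i > 0" "map_matrix real_of_int A *v u = 0"
    using A by (auto simp: affine_cartan_matrix_def)
  have "(\<Sum>j\<in>UNIV. of_int (A $ i $ j) * u $ j) = 0" for i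
    using u(2) by (simp add: vec_eq_iff matrix_vector_mult_def map_matrix_def)
  with u(1) show False using affine_contradiction[of "\<lambda>i. u $ i"] by blast
qed

theorem theorem3:
  fixes A :: "int^'i^'i"
    and sh :: "complex \<Rightarrow> 'h::ab_group_add \<Rightarrow> 'h"
    and \<alpha> :: "'i \<Rightarrow> 'h \<Rightarrow> complex"
    and \<alpha>v :: "'i \<Rightarrow> 'h"
  assumes "affine_cartan_matrix A"
    and "realization A sh \<alpha> \<alpha>v"
  shows "category_H sh \<alpha> \<alpha>v =
    ({} :: ((complex \<Rightarrow> 'v::ab_group_add \<Rightarrow> 'v) \<times>
            (('i, 'h) km_gen alg_term set set \<Rightarrow> 'v \<Rightarrow> 'v)) set)"
  using affine_category_H_empty[OF assms] by auto

end
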